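(* Consider the Feedback MAB problem (defined in the context). (a) There is a family of instances, one for each $n$, in which the value of the optimal policy is $\Omega(n)$ times the value of the myopic policy, i.e. the policy that at every step plays the arm with the highest expected reward at that step given the current information. (b) There is an instance in which the value of the optimal policy exceeds the value of every index policy by at least a constant factor, i.e. it is at least $(1+c)$ times the value of any index policy for some absolute constant $c>0$.
   Context: Feedback MAB: there are $n$ arms. Arm $i$ has a good state $g_i$ and a bad state $b_i$ and a reward value $r_i$. The state of arm $i$ evolves as a discrete-time two-state Markov chain, independently of the other arms and independently of whether it is played, with $\Pr[s_{i,t+1}=g_i\mid s_{i,t}=b_i]=\alpha_i$ and $\Pr[s_{i,t+1}=b_i\mid s_{i,t}=g_i]=\beta_i$, where $\alpha_i+\beta_i\le 1-\delta$ for a given $\delta>0$. At each time step a policy plays at most one arm; playing arm $i$ yields reward $r_i$ if arm $i$ is currently in state $g_i$ and $0$ otherwise, and reveals to the policy the current state of arm $i$. The states of arms that are not played are not observed. The value of a policy is its infinite-horizon time-average expected reward $\lim_{T\to\infty}\frac1T\sum_{t<T}\mathbb{E}[R_t]$. From the policy's perspective the state of arm $i$ is summarized by a pair $(s,t)$: it was last observed $t\ge1$ steps ago to be in state $s\in\{g,b\}$. An index policy assigns a real number (index) to every pair (arm $i$, state $(s,t)$) and at each step plays the arm whose current state has the highest index (a dummy arm yielding no reward may be used to allow idling). *)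

theory Defs
  imports "HOL-Probability.Probability"
begin

text \<open>
  A two-state arm has state \<^term>\<open>True\<close> (good) or \<^term>\<open>False\<close> (bad); the arms of an instance
  are \<open>0, \<dots>, arms I - 1\<close>.
\<close>

record feedback_mab =
  arms :: nat
  alpha :: "nat \<Rightarrow> real"
  beta :: "nat \<Rightarrow> real"
  reward :: "nat \<Rightarrow> real"

definition is_feedback_mab :: "real \<Rightarrow> feedback_mab \<Rightarrow> bool" where
  "is_feedback_mab \<delta> I \<longleftrightarrow> 0 < \<delta> \<and>
     (\<forall>i < arms I. 0 \<le> alpha I i \<and> 0 \<le> beta I i \<and> alpha I i + beta I i \<le> 1 - \<delta> \<and> 0 \<le> reward I i)"

definition arm_step :: "feedback_mab \<Rightarrow> nat \<Rightarrow> bool \<Rightarrow> bool pmf" where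
  "arm_step I i s = bernoulli_pmf (if s then 1 - beta I i else alpha I i)"

primrec arm_steps :: "feedback_mab \<Rightarrow> nat \<Rightarrow> bool \<Rightarrow> nat \<Rightarrow> bool pmf" where
  "arm_steps I i s 0 = return_pmf s"
| "arm_steps I i s (Suc t) = bind_pmf (arm_steps I i s t) (arm_step I i)"

text \<open>
  The information about an arm is a pair \<open>(s, t)\<close>: it was last observed \<open>t\<close> steps ago, in state \<open>s\<close>.
  A history lists what happened so far, most recent step first: \<^term>\<open>None\<close> is an idle step and
  \<^term>\<open>Some (i, s)\<close> a play of arm \<open>i\<close> that found it in state \<open>s\<close>.
\<close>

type_synonym info = "nat \<Rightarrow> bool \<times> nat"
type_synonym history = "(nat \<times> bool) option list"
type_synonym policy = "history \<Rightarrow> nat option"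

definition initial_info :: "feedback_mab \<Rightarrow> info \<Rightarrow> bool" where
  "initial_info I \<nu> \<longleftrightarrow> (\<forall>i < arms I. 1 \<le> snd (\<nu> i))"

fun current_info :: "info \<Rightarrow> history \<Rightarrow> info" where
  "current_info \<nu> [] = \<nu>"
| "current_info \<nu> (ob # h) = (\<lambda>i.
     case ob of
       Some (j, s) \<Rightarrow>
         if i = j then (s, 1) else (fst (current_info \<nu> h i), Suc (snd (current_info \<nu> h i)))
     | None \<Rightarrow> (fst (current_info \<nu> h i), Suc (snd (current_info \<nu> h i))))"

definition actions :: "feedback_mab \<Rightarrow> nat option set" where
  "actions I = insert None (Some ` {..<arms I})"

definition policies :: "feedback_mab \<Rightarrow> policy set" where
  "policies I = {\<pi>. \<forall>h. \<pi> h \<in> actions I}"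

text \<open>
  \<open>run I \<nu> \<pi> T\<close> is the joint law of the hidden arm states at time \<open>T\<close> and the history of the first
  \<open>T\<close> steps. All arms move in every step, independently of each other and of the action; the
  policy only sees the history.
\<close>

primrec run :: "feedback_mab \<Rightarrow> info \<Rightarrow> policy \<Rightarrow> nat \<Rightarrow> ((nat \<Rightarrow> bool) \<times> history) pmf" where
  "run I \<nu> \<pi> 0 =
     map_pmf (\<lambda>x. (x, [])) (Pi_pmf {..<arms I} False (\<lambda>i. arm_steps I i (fst (\<nu> i)) (snd (\<nu> i))))"
| "run I \<nu> \<pi> (Suc T) =
     bind_pmf (run I \<nu> \<pi> T) (\<lambda>(x, h).
       map_pmf (\<lambda>y. (y, map_option (\<lambda>i. (i, x i)) (\<pi> h) # h))
         (Pi_pmf {..<arms I} False (\<lambda>i. arm_step I i (x i))))"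

definition gain :: "feedback_mab \<Rightarrow> nat option \<Rightarrow> (nat \<Rightarrow> bool) \<Rightarrow> real" where
  "gain I a x = (case a of None \<Rightarrow> 0 | Some i \<Rightarrow> if x i then reward I i else 0)"

definition expected_reward :: "feedback_mab \<Rightarrow> info \<Rightarrow> policy \<Rightarrow> nat \<Rightarrow> real" where
  "expected_reward I \<nu> \<pi> T = measure_pmf.expectation (run I \<nu> \<pi> T) (\<lambda>(x, h). gain I (\<pi> h) x)"

definition average_reward :: "feedback_mab \<Rightarrow> info \<Rightarrow> policy \<Rightarrow> nat \<Rightarrow> real" where
  "average_reward I \<nu> \<pi> T = (\<Sum>t<T. expected_reward I \<nu> \<pi> t) / real T"

text \<open>
  The limit of the averages need not exist for a history-dependent policy. Whenever it exists, it
  equals both of the following values. The supremum defining \<open>optimal_value\<close> uses the smaller one.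
\<close>

definition lower_value :: "feedback_mab \<Rightarrow> info \<Rightarrow> policy \<Rightarrow> ereal" where
  "lower_value I \<nu> \<pi> = liminf (\<lambda>T. ereal (average_reward I \<nu> \<pi> T))"

definition upper_value :: "feedback_mab \<Rightarrow> info \<Rightarrow> policy \<Rightarrow> ereal" where
  "upper_value I \<nu> \<pi> = limsup (\<lambda>T. ereal (average_reward I \<nu> \<pi> T))"

definition optimal_value :: "feedback_mab \<Rightarrow> info \<Rightarrow> ereal" where
  "optimal_value I \<nu> = (SUP \<pi> \<in> policies I. lower_value I \<nu> \<pi>)"

definition immediate_reward :: "feedback_mab \<Rightarrow> nat \<Rightarrow> bool \<times> nat \<Rightarrow> real" where
  "immediate_reward I i = (\<lambda>(s, t). reward I i * pmf (arm_steps I i s t) True)"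

definition myopic_policy :: "feedback_mab \<Rightarrow> info \<Rightarrow> policy \<Rightarrow> bool" where
  "myopic_policy I \<nu> \<pi> \<longleftrightarrow>
     (\<forall>h. \<exists>i < arms I. \<pi> h = Some i \<and>
        (\<forall>j < arms I. immediate_reward I j (current_info \<nu> h j)
                     \<le> immediate_reward I i (current_info \<nu> h i)))"

text \<open>
  \<open>\<gamma> i (s, t)\<close> is the index of arm \<open>i\<close> in state \<open>(s, t)\<close>, and \<open>\<gamma>0\<close> that of the dummy arm, whose play
  is the action \<^term>\<open>None\<close>. Policies without a dummy arm are included, because the \<open>\<gamma> i\<close> can be
  rescaled to a bounded range lying above \<open>\<gamma>0\<close>.
  Ties are broken by a fixed priority among the arms. If ties could be broken depending on the
  states of all arms, then constant indices would yield every stationary policy.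
\<close>

definition action_index ::
  "(nat \<Rightarrow> bool \<times> nat \<Rightarrow> real) \<Rightarrow> real \<Rightarrow> info \<Rightarrow> nat option \<Rightarrow> real" where
  "action_index \<gamma> \<gamma>0 \<kappa> a = (case a of None \<Rightarrow> \<gamma>0 | Some i \<Rightarrow> \<gamma> i (\<kappa> i))"

definition index_policy :: "feedback_mab \<Rightarrow> info \<Rightarrow> policy \<Rightarrow> bool" where
  "index_policy I \<nu> \<pi> \<longleftrightarrow>
     (\<exists>\<gamma> \<gamma>0 (prio :: nat option \<Rightarrow> nat). inj_on prio (actions I) \<and>
        (\<forall>h. \<pi> h \<in> actions I \<and>
          (\<forall>a \<in> actions I - {\<pi> h}.
             let u = action_index \<gamma> \<gamma>0 (current_info \<nu> h) a;
                 v = action_index \<gamma> \<gamma>0 (current_info \<nu> h) (\<pi> h)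
             in u < v \<or> (u = v \<and> prio a < prio (\<pi> h)))))"

end

theory Submission
  imports Defs
begin

text \<open>
  Given the history, the hidden states are independent and each is described by its pair \<open>(s, t)\<close>,
  so a bounded function \<open>\<Phi>\<close> of these pairs certifies a bound on the value: if in every step
  the expected reward plus the expected next value of \<open>\<Phi>\<close> is at most (at least) \<open>g + \<Phi>\<close>, then
  the long-run average is at most (at least) \<open>g\<close>.

  (a) Take one safe arm, whose good state is absorbing and whose reward is about \<open>2 / n\<close>, and \<open>n - 1\<close>
  slowly changing arms of reward \<open>1\<close> that are good with stationary probability about \<open>1 / n\<close>. An arm last
  seen bad looks worse than the safe arm, so the myopic policy eventually never explores. A policy
  that searches for a good arm needs about \<open>n\<close> steps to find one and can exploit it for about \<open>n\<close> steps.

  (b) Take a safe arm, a fast arm and a slow arm. After a play of the safe arm, with the fast arm found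
  bad two steps ago, it depends on the slow arm whether the safe or the fast arm should be played. An
  index policy must rank these two arms the same way every time, hence never plays the safe arm or never
  plays the fast arm in this situation. Each restriction costs a fixed fraction of the value, as
  certified by a potential \<open>\<Phi>\<close> that depends only on finitely many classes of observations.
\<close>

section \<open>Filtering and drift conditions\<close>

definition belief :: "feedback_mab \<Rightarrow> info \<Rightarrow> nat \<Rightarrow> real" where
  "belief I \<kappa> i = pmf (arm_steps I i (fst (\<kappa> i)) (snd (\<kappa> i))) True"

definition expected_gain :: "feedback_mab \<Rightarrow> info \<Rightarrow> nat option \<Rightarrow> real" where
  "expected_gain I \<kappa> a = (case a of None \<Rightarrow> 0 | Some i \<Rightarrow> reward I i * belief I \<kappa> i)"

fun observe :: "info \<Rightarrow> (nat \<times> bool) option \<Rightarrow> info" where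
  "observe \<kappa> None = (\<lambda>i. (fst (\<kappa> i), Suc (snd (\<kappa> i))))"
| "observe \<kappa> (Some (j, s)) = (\<lambda>i. if i = j then (s, 1) else (fst (\<kappa> i), Suc (snd (\<kappa> i))))"

lemma current_info_Cons: "current_info \<nu> (ob # h) = observe (current_info \<nu> h) ob"
  by (cases "(current_info \<nu> h, ob)" rule: observe.cases) (auto simp: fun_eq_iff)

declare current_info.simps(2) [simp del]
declare current_info_Cons [simp]

definition expected_next :: "feedback_mab \<Rightarrow> (info \<Rightarrow> real) \<Rightarrow> info \<Rightarrow> nat option \<Rightarrow> real" where
  "expected_next I \<Phi> \<kappa> a = (case a of None \<Rightarrow> \<Phi> (observe \<kappa> None)
     | Some i \<Rightarrow> belief I \<kappa> i * \<Phi> (observe \<kappa> (Some (i, True)))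
               + (1 - belief I \<kappa> i) * \<Phi> (observe \<kappa> (Some (i, False))))"

text \<open>Law of the history alone: the observed state is drawn from the belief about the played
  arm, so the hidden states need not be carried along.\<close>

primrec history_pmf :: "feedback_mab \<Rightarrow> info \<Rightarrow> policy \<Rightarrow> nat \<Rightarrow> history pmf" where
  "history_pmf I \<nu> \<pi> 0 = return_pmf []"
| "history_pmf I \<nu> \<pi> (Suc T) = bind_pmf (history_pmf I \<nu> \<pi> T) (\<lambda>h.
     case \<pi> h of None \<Rightarrow> return_pmf (None # h)
     | Some i \<Rightarrow> map_pmf (\<lambda>s. Some (i, s) # h)
         (arm_steps I i (fst (current_info \<nu> h i)) (snd (current_info \<nu> h i))))"

section \<open>Conditioning the hidden states on the history\<close>

text \<open>By independence coordinate \<open>i\<close> may be drawn first, and fixing it leaves the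
  other factors untouched. This is how an observation enters the product law.\<close>

lemma Pi_pmf_condition:
  assumes "finite A" "i \<in> A"
  shows "Pi_pmf A d p = bind_pmf (p i) (\<lambda>s. Pi_pmf A d (p(i := return_pmf s)))"
proof -
  have A: "A = insert i (A - {i})" "finite (A - {i})" "i \<notin> A - {i}"
    using assms by auto
  have eq: "Pi_pmf (A - {i}) d (p(i := return_pmf s)) = Pi_pmf (A - {i}) d p" for s
    by (intro Pi_pmf_cong) auto
  have "Pi_pmf A d (p(i := return_pmf s)) = bind_pmf (Pi_pmf (A - {i}) d p) (\<lambda>f. return_pmf (f(i := s)))" for s
    by (subst A(1), subst Pi_pmf_insert'[OF A(2,3)]) (simp add: eq bind_return_pmf)
  moreover have "Pi_pmf A d p = bind_pmf (p i) (\<lambda>s. bind_pmf (Pi_pmf (A - {i}) d p) (\<lambda>f. return_pmf (f(i := s))))"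
    by (subst A(1), subst Pi_pmf_insert'[OF A(2,3)]) simp
  ultimately show ?thesis by simp
qed

lemma Pi_pmf_arm_step:
  "bind_pmf (Pi_pmf {..<n} False \<sigma>) (\<lambda>x. map_pmf (\<lambda>y. (y, c)) (Pi_pmf {..<n} False (\<lambda>j. arm_step I j (x j))))
   = map_pmf (\<lambda>y. (y, c)) (Pi_pmf {..<n} False (\<lambda>j. bind_pmf (\<sigma> j) (arm_step I j)))"
  by (subst Pi_pmf_bind[where d' = False]) (simp_all add: map_bind_pmf)

lemma Pi_pmf_arm_step_observe:
  assumes i: "i < n"
  shows "bind_pmf (Pi_pmf {..<n} False \<sigma>)
      (\<lambda>x. map_pmf (\<lambda>y. (y, c (x i))) (Pi_pmf {..<n} False (\<lambda>j. arm_step I j (x j))))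
    = bind_pmf (\<sigma> i) (\<lambda>s. map_pmf (\<lambda>y. (y, c s))
        (Pi_pmf {..<n} False (\<lambda>j. bind_pmf ((\<sigma>(i := return_pmf s)) j) (arm_step I j))))"
proof -
  let ?P = "Pi_pmf {..<n} False"
  have obs: "x i = s" if "x \<in> set_pmf (?P (\<sigma>(i := return_pmf s)))" for x s
  proof -
    have "x \<in> PiE_dflt {..<n} False (set_pmf \<circ> (\<sigma>(i := return_pmf s)))"
      using that by (simp only: set_Pi_pmf finite_lessThan)
    then have "x i \<in> (set_pmf \<circ> (\<sigma>(i := return_pmf s))) i"
      unfolding PiE_dflt_def using i by (metis (mono_tags, lifting) lessThan_iff mem_Collect_eq)
    then show ?thesis by simp
  qed
  have "bind_pmf (?P \<sigma>) (\<lambda>x. map_pmf (\<lambda>y. (y, c (x i))) (?P (\<lambda>j. arm_step I j (x j))))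
    = bind_pmf (\<sigma> i) (\<lambda>s. bind_pmf (?P (\<sigma>(i := return_pmf s)))
        (\<lambda>x. map_pmf (\<lambda>y. (y, c (x i))) (?P (\<lambda>j. arm_step I j (x j)))))"
    by (subst Pi_pmf_condition[of "{..<n}" i False \<sigma>]) (use i in \<open>simp_all add: bind_assoc_pmf\<close>)
  also have "\<dots> = bind_pmf (\<sigma> i) (\<lambda>s. bind_pmf (?P (\<sigma>(i := return_pmf s)))
        (\<lambda>x. map_pmf (\<lambda>y. (y, c s)) (?P (\<lambda>j. arm_step I j (x j)))))"
    by (rule bind_pmf_cong[OF refl], rule bind_pmf_cong[OF refl], drule obs, simp)
  also have "\<dots> = bind_pmf (\<sigma> i) (\<lambda>s. map_pmf (\<lambda>y. (y, c s))
        (?P (\<lambda>j. bind_pmf ((\<sigma>(i := return_pmf s)) j) (arm_step I j))))"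
    by (simp only: Pi_pmf_arm_step)
  finally show ?thesis .
qed

text \<open>Induction on \<open>T\<close>: given the history, the hidden states form a product. An
  observation turns the factor of the played arm into a point mass; the common step then makes its
  age 1 and ages every other factor by one.\<close>

lemma run_eq_history_pmf:
  assumes "\<pi> \<in> policies I"
  shows "run I \<nu> \<pi> T = bind_pmf (history_pmf I \<nu> \<pi> T) (\<lambda>h. map_pmf (\<lambda>x. (x, h))
    (Pi_pmf {..<arms I} False (\<lambda>i. arm_steps I i (fst (current_info \<nu> h i)) (snd (current_info \<nu> h i)))))"
proof (induction T)
  case 0
  show ?case by (simp add: bind_return_pmf)
next
  case (Suc T)
  let ?\<sigma> = "\<lambda>h i. arm_steps I i (fst (current_info \<nu> h i)) (snd (current_info \<nu> h i))"
  let ?P = "Pi_pmf {..<arms I} False"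
  have step: "bind_pmf (?P (?\<sigma> h)) (\<lambda>x. map_pmf (\<lambda>y. (y, map_option (\<lambda>i. (i, x i)) (\<pi> h) # h))
         (?P (\<lambda>i. arm_step I i (x i)))) =
      bind_pmf (case \<pi> h of None \<Rightarrow> return_pmf (None # h)
         | Some i \<Rightarrow> map_pmf (\<lambda>s. Some (i, s) # h) (?\<sigma> h i))
        (\<lambda>h'. map_pmf (\<lambda>x. (x, h')) (?P (?\<sigma> h')))" for h
  proof (cases "\<pi> h")
    case None
    then show ?thesis
      by (simp add: bind_return_pmf Pi_pmf_arm_step)
  next
    case (Some i)
    then have i: "i < arms I"
      using assms by (auto simp: policies_def actions_def dest: spec[of _ h])
    have eq: "?P (\<lambda>j. bind_pmf (((?\<sigma> h)(i := return_pmf s)) j) (arm_step I j)) = ?P (?\<sigma> (Some (i, s) # h))" for s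
      by (intro Pi_pmf_cong) (auto simp: bind_return_pmf)
    show ?thesis
      unfolding Some option.map option.case bind_map_pmf
        Pi_pmf_arm_step_observe[of i "arms I" "?\<sigma> h" "\<lambda>s. Some (i, s) # h", OF i] eq ..
  qed
  show ?case
    by (simp only: run.simps Suc.IH history_pmf.simps bind_assoc_pmf bind_map_pmf case_prod_conv step)
qed

text \<open>Finite support makes every function of the history integrable; the length lets a drift
  condition be demanded of late histories only.\<close>

lemma set_history_pmf:
  shows finite_set_history_pmf: "finite (set_pmf (history_pmf I \<nu> \<pi> T))"
    and length_history_pmf: "h \<in> set_pmf (history_pmf I \<nu> \<pi> T) \<Longrightarrow> length h = T"
proof (induction T arbitrary: h)
  case (Suc T)
  {
    case 1
    show ?case using Suc.IH(1) by (auto split: option.split)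
  next
    case 2
    then show ?case using Suc.IH(2) by (auto split: option.splits)
  }
qed auto

lemma expectation_bool_pmf:
  fixes f :: "bool \<Rightarrow> real"
  shows "measure_pmf.expectation p f = pmf p True * f True + (1 - pmf p True) * f False"
  by (subst integral_measure_pmf_real[of UNIV]) (auto simp: UNIV_bool pmf_False_conv_True algebra_simps)

lemma expected_reward_eq:
  assumes "\<pi> \<in> policies I"
  shows "expected_reward I \<nu> \<pi> T =
    measure_pmf.expectation (history_pmf I \<nu> \<pi> T) (\<lambda>h. expected_gain I (current_info \<nu> h) (\<pi> h))"
proof -
  let ?\<sigma> = "\<lambda>h i. arm_steps I i (fst (current_info \<nu> h i)) (snd (current_info \<nu> h i))"
  have fin: "finite (set_pmf (Pi_pmf {..<arms I} False (?\<sigma> h)))" for h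
    by (rule finite_subset[OF set_Pi_pmf_subset'])
       (auto intro!: finite_PiE_dflt)
  have *: "measure_pmf.expectation (Pi_pmf {..<arms I} False (?\<sigma> h)) (gain I (\<pi> h))
    = expected_gain I (current_info \<nu> h) (\<pi> h)" for h
  proof (cases "\<pi> h")
    case None
    then show ?thesis by (simp add: gain_def[abs_def] expected_gain_def)
  next
    case (Some i)
    then have i: "i < arms I"
      using assms by (auto simp: policies_def actions_def dest: spec[of _ h])
    have "measure_pmf.expectation (Pi_pmf {..<arms I} False (?\<sigma> h)) (gain I (\<pi> h))
      = measure_pmf.expectation (map_pmf (\<lambda>x. x i) (Pi_pmf {..<arms I} False (?\<sigma> h)))
          (\<lambda>s. if s then reward I i else 0)"
      using Some by (simp add: gain_def[abs_def])
    then show ?thesis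
      using i Some by (simp add: Pi_pmf_component expectation_bool_pmf expected_gain_def belief_def mult.commute)
  qed
  show ?thesis
    unfolding expected_reward_def run_eq_history_pmf[OF assms]
    by (subst pmf_expectation_bind[where A = "set_pmf (history_pmf I \<nu> \<pi> T)"])
       (auto simp: finite_set_history_pmf fin * integral_measure_pmf_real[OF finite_set_history_pmf] mult.commute)
qed

lemma expectation_history_pmf_Suc:
  "measure_pmf.expectation (history_pmf I \<nu> \<pi> (Suc T)) (\<lambda>h. \<Phi> (current_info \<nu> h)) =
   measure_pmf.expectation (history_pmf I \<nu> \<pi> T) (\<lambda>h. expected_next I \<Phi> (current_info \<nu> h) (\<pi> h))"
proof -
  have fin: "finite (set_pmf (case \<pi> h of None \<Rightarrow> return_pmf (None # h)
     | Some i \<Rightarrow> map_pmf (\<lambda>s. Some (i, s) # h)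
         (arm_steps I i (fst (current_info \<nu> h i)) (snd (current_info \<nu> h i)))))" for h
    by (auto split: option.split)
  have *: "measure_pmf.expectation (case \<pi> h of None \<Rightarrow> return_pmf (None # h)
     | Some i \<Rightarrow> map_pmf (\<lambda>s. Some (i, s) # h)
         (arm_steps I i (fst (current_info \<nu> h i)) (snd (current_info \<nu> h i)))) (\<lambda>h. \<Phi> (current_info \<nu> h))
      = expected_next I \<Phi> (current_info \<nu> h) (\<pi> h)" for h
    by (cases "\<pi> h") (simp_all add: expected_next_def expectation_bool_pmf belief_def)
  show ?thesis
    unfolding history_pmf.simps
    by (subst pmf_expectation_bind[where A = "set_pmf (history_pmf I \<nu> \<pi> T)"])
       (auto simp: finite_set_history_pmf fin * integral_measure_pmf_real[OF finite_set_history_pmf] mult.commute)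
qed

section \<open>Bounds on long-run averages from potentials\<close>

text \<open>The inequalities telescope from \<open>N\<close> on. The first \<open>N\<close> rewards
  and the bounded boundary terms of \<open>e\<close> amount to a constant, which vanishes after
  division by \<open>T\<close>.\<close>

lemma Cesaro_limsup_le:
  fixes r e :: "nat \<Rightarrow> real"
  assumes step: "\<And>t. N \<le> t \<Longrightarrow> r t + e (Suc t) \<le> g + e t" and bounded: "\<And>t. \<bar>e t\<bar> \<le> B"
  shows "limsup (\<lambda>T. ereal ((\<Sum>t<T. r t) / real T)) \<le> ereal g"
proof -
  define K where "K = (\<Sum>t<N. r t) - g * real N + 2 * B"
  have sum: "(\<Sum>t<T. r t) \<le> (\<Sum>t<N. r t) + g * (real T - real N) + e N - e T" if "N \<le> T" for T
    using that
  proof (induction T rule: dec_induct)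
    case (step T)
    then show ?case using assms(1)[of T] by (simp add: algebra_simps)
  qed simp
  have "(\<Sum>t<T. r t) / real T \<le> g + K / real T" if "max 1 N \<le> T" for T
  proof -
    have "(\<Sum>t<T. r t) \<le> K + g * real T"
      using sum[of T] that bounded[of N] bounded[of T] by (auto simp: K_def algebra_simps abs_le_iff)
    then show ?thesis using that by (simp add: field_simps)
  qed
  then have "\<forall>\<^sub>F T in sequentially. ereal ((\<Sum>t<T. r t) / real T) \<le> ereal (g + K / real T)"
    unfolding eventually_sequentially by (intro exI[of _ "max 1 N"]) auto
  then have "limsup (\<lambda>T. ereal ((\<Sum>t<T. r t) / real T)) \<le> limsup (\<lambda>T. ereal (g + K / real T))"
    by (rule Limsup_mono)
  also have "\<dots> = ereal g"
  proof (rule lim_imp_Limsup)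
    have "(\<lambda>T. g + K / real T) \<longlonglongrightarrow> g + 0"
      by (intro tendsto_intros lim_const_over_n)
    then show "(\<lambda>T. ereal (g + K / real T)) \<longlonglongrightarrow> ereal g" by simp
  qed simp
  finally show ?thesis .
qed

lemma Cesaro_liminf_ge:
  fixes r e :: "nat \<Rightarrow> real"
  assumes step: "\<And>t. N \<le> t \<Longrightarrow> g + e t \<le> r t + e (Suc t)" and bounded: "\<And>t. \<bar>e t\<bar> \<le> B"
  shows "ereal g \<le> liminf (\<lambda>T. ereal ((\<Sum>t<T. r t) / real T))"
proof -
  have "limsup (\<lambda>T. ereal ((\<Sum>t<T. - r t) / real T)) \<le> ereal (- g)"
    using assms by (intro Cesaro_limsup_le[where e = "\<lambda>t. - e t" and N = N and B = B]) (auto simp: algebra_simps)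
  moreover have "(\<lambda>T. ereal ((\<Sum>t<T. - r t) / real T)) = (\<lambda>T. - ereal ((\<Sum>t<T. r t) / real T))"
    by (simp add: sum_negf)
  ultimately show ?thesis
    by (simp add: ereal_Limsup_uminus flip: uminus_ereal.simps(1))
qed

text \<open>\<open>expected_next\<close> is the conditional expectation of the next value of
  \<open>\<Phi>\<close>. Averaging the drift inequality over the histories of length
  \<open>T\<close> therefore gives the one-step inequality of the Cesaro lemmas.\<close>

lemma
  fixes \<Phi> :: "info \<Rightarrow> real"
  assumes \<pi>: "\<pi> \<in> policies I" and bounded: "\<And>\<kappa>. \<bar>\<Phi> \<kappa>\<bar> \<le> B"
  shows upper_value_le:
    "(\<And>h. N \<le> length h \<Longrightarrow> expected_gain I (current_info \<nu> h) (\<pi> h)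
          + expected_next I \<Phi> (current_info \<nu> h) (\<pi> h) \<le> g + \<Phi> (current_info \<nu> h))
     \<Longrightarrow> upper_value I \<nu> \<pi> \<le> ereal g" (is "PROP ?U \<Longrightarrow> _")
  and lower_value_ge:
    "(\<And>h. N \<le> length h \<Longrightarrow> g + \<Phi> (current_info \<nu> h) \<le> expected_gain I (current_info \<nu> h) (\<pi> h)
          + expected_next I \<Phi> (current_info \<nu> h) (\<pi> h))
     \<Longrightarrow> ereal g \<le> lower_value I \<nu> \<pi>" (is "PROP ?L \<Longrightarrow> _")
proof -
  define E where "E T f = measure_pmf.expectation (history_pmf I \<nu> \<pi> T) f" for T and f :: "history \<Rightarrow> real"
  define e where "e T = E T (\<lambda>h. \<Phi> (current_info \<nu> h))" for T
  have int: "integrable (measure_pmf (history_pmf I \<nu> \<pi> T)) (f :: history \<Rightarrow> real)" for T f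
    by (rule integrable_measure_pmf_finite[OF finite_set_history_pmf])
  have mono: "E T f \<le> E T f'" if "\<And>h. h \<in> set_pmf (history_pmf I \<nu> \<pi> T) \<Longrightarrow> f h \<le> f' h" for T f f'
    unfolding E_def using that by (intro integral_mono_AE int) (auto simp: AE_measure_pmf_iff)
  have const: "E T (\<lambda>_. c) = c" for T c
    by (simp add: E_def)
  have add: "E T (\<lambda>h. f h + f' h) = E T f + E T f'" for T f f'
    unfolding E_def by (rule Bochner_Integration.integral_add[OF int int])
  have bd: "\<bar>e T\<bar> \<le> B" for T
    using mono[of T "\<lambda>h. \<Phi> (current_info \<nu> h)" "\<lambda>_. B"] mono[of T "\<lambda>_. - B" "\<lambda>h. \<Phi> (current_info \<nu> h)"] bounded
    by (auto simp: e_def const abs_le_iff minus_le_iff)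
  have drift: "expected_reward I \<nu> \<pi> T + e (Suc T) = E T (\<lambda>h. expected_gain I (current_info \<nu> h) (\<pi> h)
          + expected_next I \<Phi> (current_info \<nu> h) (\<pi> h))" for T
    by (simp add: add expected_reward_eq[OF \<pi>] e_def E_def expectation_history_pmf_Suc del: history_pmf.simps)
  have base: "g + e T = E T (\<lambda>h. g + \<Phi> (current_info \<nu> h))" for T
    by (simp add: add const e_def)
  {
    assume U: "PROP ?U"
    have "expected_reward I \<nu> \<pi> T + e (Suc T) \<le> g + e T" if "N \<le> T" for T
      unfolding drift base using that by (intro mono U) (simp add: length_history_pmf)
    then show "upper_value I \<nu> \<pi> \<le> ereal g"
      unfolding upper_value_def average_reward_def by (rule Cesaro_limsup_le[OF _ bd])
  }
  {
    assume L: "PROP ?L"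
    have "g + e T \<le> expected_reward I \<nu> \<pi> T + e (Suc T)" if "N \<le> T" for T
      unfolding drift base using that by (intro mono L) (simp add: length_history_pmf)
    then show "ereal g \<le> lower_value I \<nu> \<pi>"
      unfolding lower_value_def average_reward_def by (rule Cesaro_liminf_ge[OF _ bd])
  }
qed

section \<open>The gap of the myopic policy\<close>

lemma pmf_arm_steps_Suc:
  assumes "is_feedback_mab \<delta> I" "i < arms I"
  shows "pmf (arm_steps I i s (Suc t)) True =
    alpha I i + (1 - alpha I i - beta I i) * pmf (arm_steps I i s t) True"
proof -
  have "0 < \<delta>" "0 \<le> alpha I i" "0 \<le> beta I i" "alpha I i + beta I i \<le> 1 - \<delta>"
    using assms by (auto simp: is_feedback_mab_def)
  then have step: "pmf (arm_step I i True) True = 1 - beta I i" "pmf (arm_step I i False) True = alpha I i"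
    by (simp_all add: arm_step_def)
  show ?thesis
    by (simp add: pmf_bind expectation_bool_pmf step) (simp add: algebra_simps)
qed

lemma belief_bounds: "0 \<le> belief I \<kappa> i" "belief I \<kappa> i \<le> 1"
  by (simp_all add: belief_def pmf_le_1)

lemma observation_age_pos:
  assumes "initial_info I \<nu>" "i < arms I"
  shows "1 \<le> snd (current_info \<nu> h i)"
proof (induction h)
  case (Cons ob h)
  then show ?case
    by (cases "(current_info \<nu> h, ob)" rule: observe.cases) auto
qed (use assms in \<open>simp add: initial_info_def\<close>)

lemma myopic_policyE:
  assumes "myopic_policy I \<nu> \<pi>"
  obtains i where "i < arms I" "\<pi> h = Some i"
    "\<And>j. j < arms I \<Longrightarrow> reward I j * belief I (current_info \<nu> h) j \<le> reward I i * belief I (current_info \<nu> h) i"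
proof -
  have "immediate_reward I i (\<kappa> i) = reward I i * belief I \<kappa> i" for i \<kappa>
    by (simp add: immediate_reward_def belief_def case_prod_beta)
  then show ?thesis
    using assms that unfolding myopic_policy_def by metis
qed

lemma myopic_policy_in_policies: "myopic_policy I \<nu> \<pi> \<Longrightarrow> \<pi> \<in> policies I"
  unfolding policies_def actions_def by (blast elim: myopic_policyE)

text \<open>At most one arm is observed per step.\<close>

lemma card_recently_observed:
  assumes "initial_info I \<nu>" "k \<le> length h"
  shows "card {i. i < arms I \<and> snd (current_info \<nu> h i) \<le> k} \<le> k"
  using assms(2)
proof (induction h arbitrary: k)
  case Nil
  then show ?case using assms(1) by (auto simp: initial_info_def)
next
  case (Cons ob h)
  let ?S = "\<lambda>h k. {i. i < arms I \<and> snd (current_info \<nu> h i) \<le> k}"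
  show ?case
  proof (cases k)
    case 0
    then have "?S (ob # h) k = {}"
      using observation_age_pos[OF assms(1), of _ "ob # h"] 0 by (fastforce simp del: current_info_Cons)
    then show ?thesis by (simp only: card.empty le0)
  next
    case (Suc k')
    have "\<exists>j. ?S (ob # h) k \<subseteq> insert j (?S h k')"
    proof (cases ob)
      case None
      then show ?thesis by (auto simp: Suc)
    next
      case (Some a)
      then show ?thesis by (cases a) (auto simp: Suc intro!: exI[of _ "fst a"])
    qed
    then obtain j where "?S (ob # h) k \<subseteq> insert j (?S h k')" ..
    then have "card (?S (ob # h) k) \<le> card (insert j (?S h k'))"
      by (intro card_mono) auto
    also have "\<dots> \<le> Suc (card (?S h k'))"
      by (simp add: card_insert_if)
    also have "\<dots> \<le> k"
      using Cons.IH[of k'] Cons.prems Suc by simp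
    finally show ?thesis .
  qed
qed

section \<open>The instance that defeats the myopic policy\<close>

text \<open>Arm \<open>0\<close> is the safe arm: after any observation it is good with probability
  at least \<open>1 - \<delta>\<close>, and its reward is scaled to make this worth at least
  \<open>2 / n\<close>. This is twice the bound \<open>1 / n\<close> on the belief in another arm
  last seen bad. The other arms have \<open>\<alpha> = \<beta> / n\<close>, with
  \<open>1 / \<beta>\<close> of order \<open>n\<close>.\<close>

definition needle_mab :: "real \<Rightarrow> nat \<Rightarrow> feedback_mab" where
  "needle_mab \<delta> n = \<lparr>arms = n,
     alpha = (\<lambda>i. if i = 0 then 1 - \<delta> else (1 - \<delta>) / (2 * real n ^ 2)),
     beta = (\<lambda>i. if i = 0 then 0 else (1 - \<delta>) / (2 * real n)),
     reward = (\<lambda>i. if i = 0 then 2 / (real n * (1 - \<delta>)) else 1)\<rparr>"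

context
  fixes \<delta> :: real and n :: nat and I :: feedback_mab and A B R :: real
  assumes \<delta>: "0 < \<delta>" "\<delta> < 1" and n: "1 \<le> n"
  defines "I \<equiv> needle_mab \<delta> n" and "A \<equiv> (1 - \<delta>) / (2 * real n ^ 2)" and "B \<equiv> (1 - \<delta>) / (2 * real n)"
    and "R \<equiv> 2 / (real n * (1 - \<delta>))"
begin

lemma needle_rates: "0 < A" "A = B / real n" "A \<le> B" "0 < B" "B \<le> (1 - \<delta>) / 2" "0 < R"
    "R * (1 - \<delta>) = 2 / real n"
proof -
  show B: "0 < B" and "0 < A" and A: "A = B / real n" and "0 < R" and "R * (1 - \<delta>) = 2 / real n"
    using \<delta> n by (simp_all add: A_def B_def R_def power2_eq_square field_simps)
  show "A \<le> B" using B n by (simp add: A divide_le_eq)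
  have "(1 - \<delta>) / (2 * real n) \<le> (1 - \<delta>) / 2" using \<delta> n by (intro divide_left_mono) auto
  then show "B \<le> (1 - \<delta>) / 2" by (simp add: B_def)
qed

lemma needle_simps [simp]: "arms I = n" "alpha I i = (if i = 0 then 1 - \<delta> else A)"
    "beta I i = (if i = 0 then 0 else B)" "reward I i = (if i = 0 then R else 1)"
  by (simp_all add: I_def A_def B_def R_def needle_mab_def)

lemma is_feedback_needle_mab: "is_feedback_mab \<delta> I"
  using needle_rates \<delta> by (auto simp: is_feedback_mab_def)

lemma needle_pmf_Suc:
  "i < n \<Longrightarrow> i \<noteq> 0 \<Longrightarrow> pmf (arm_steps I i s (Suc t)) True = A + (1 - A - B) * pmf (arm_steps I i s t) True"
  "0 < n \<Longrightarrow> pmf (arm_steps I 0 s (Suc t)) True = 1 - \<delta> + \<delta> * pmf (arm_steps I 0 s t) True"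
  using pmf_arm_steps_Suc[OF is_feedback_needle_mab, of i s t] pmf_arm_steps_Suc[OF is_feedback_needle_mab, of 0 s t]
  by simp_all

lemma needle_persistence: "0 < 1 - A - B"
proof -
  have "A + B \<le> 1 - \<delta>" using needle_rates(3,5) by simp
  then show ?thesis using \<delta> by simp
qed

lemma needle_safe_belief:
  assumes "1 \<le> snd (\<kappa> 0)" shows "1 - \<delta> \<le> belief I \<kappa> 0"
proof -
  obtain t where "snd (\<kappa> 0) = Suc t" using assms by (cases "snd (\<kappa> 0)") auto
  then show ?thesis using \<delta> n by (simp add: belief_def needle_pmf_Suc del: arm_steps.simps)
qed

lemma needle_belief_le:
  assumes "i < n" "i \<noteq> 0" "1 \<le> snd (\<kappa> i)" shows "belief I \<kappa> i \<le> 1 - B"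
proof -
  obtain t where t: "snd (\<kappa> i) = Suc t" using assms by (cases "snd (\<kappa> i)") auto
  have "(1 - A - B) * pmf (arm_steps I i s t) True \<le> (1 - A - B) * 1" for s
    using needle_persistence by (intro mult_left_mono) (auto simp: pmf_le_1)
  from this[of "fst (\<kappa> i)"] show ?thesis
    using assms by (simp add: belief_def t needle_pmf_Suc del: arm_steps.simps)
qed

text \<open>The recursion for the belief has the fixed point
  \<open>A / (A + B) = 1 / (n + 1)\<close>, so a belief that starts at 0 never passes
  \<open>1 / n\<close>.\<close>

lemma needle_bad_belief_le:
  assumes "i < n" "i \<noteq> 0" "\<not> fst (\<kappa> i)" shows "belief I \<kappa> i \<le> 1 / real n"
proof -
  have "pmf (arm_steps I i False t) True \<le> 1 / real n" for t
  proof (induction t)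
    case (Suc t)
    have "A + (1 - A - B) * pmf (arm_steps I i False t) True \<le> A + (1 - A - B) * (1 / real n)"
      using Suc needle_persistence by (intro add_left_mono mult_left_mono) auto
    also have "\<dots> = 1 / real n - A / real n"
      using n by (simp add: needle_rates(2) field_simps)
    also have "\<dots> \<le> 1 / real n"
      using needle_rates n by simp
    finally show ?case
      using assms by (simp add: needle_pmf_Suc del: arm_steps.simps)
  qed simp
  then show ?thesis using assms by (simp add: belief_def)
qed

text \<open>Each step adds \<open>A\<close> and takes away the fraction \<open>A + B\<close> of the
  belief. From the level \<open>k * A / 4\<close> with \<open>k \<le> n\<close> the loss is at most
  \<open>A / 4\<close>, because \<open>(A + B) * n \<le> 1\<close>; so the lower bound can grow by
  \<open>A / 4\<close> per step, whatever was last observed.\<close>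

lemma needle_belief_ge:
  assumes "i < n" "i \<noteq> 0" "m \<le> n" "m \<le> snd (\<kappa> i)" shows "real m * A / 4 \<le> belief I \<kappa> i"
proof -
  have AB: "(A + B) * real n \<le> 1"
  proof -
    have "(A + B) * real n \<le> (2 * B) * real n"
      using needle_rates by (intro mult_right_mono) auto
    also have "\<dots> \<le> 1" using n \<delta> by (simp add: B_def)
    finally show ?thesis .
  qed
  have "real m * A / 4 \<le> pmf (arm_steps I i s t) True" if "m \<le> n" "m \<le> t" for m s t
    using that
  proof (induction t arbitrary: m)
    case (Suc t)
    have *: "real k * A / 4 + A / 4 \<le> A + (1 - A - B) * pmf (arm_steps I i s t) True" if "k \<le> n" "k \<le> t" for k
    proof -
      have "(A + B) * real k \<le> (A + B) * real n"
        using needle_rates(1,4) that by (intro mult_left_mono) auto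
      then have "A * ((A + B) * real k) \<le> A * 1"
        using AB needle_rates(1) by (intro mult_left_mono) auto
      moreover have "(1 - A - B) * (real k * A / 4) = real k * A / 4 - A * ((A + B) * real k) / 4"
        by (simp add: field_simps)
      ultimately have "real k * A / 4 + A / 4 \<le> A + (1 - A - B) * (real k * A / 4)"
        using needle_rates(1) by linarith
      also have "\<dots> \<le> A + (1 - A - B) * pmf (arm_steps I i s t) True"
        using needle_persistence Suc.IH[of k] that by (intro add_left_mono mult_left_mono) auto
      finally show ?thesis .
    qed
    show ?case
    proof (cases m)
      case (Suc k)
      then show ?thesis
        using *[of k] Suc.prems assms by (simp add: needle_pmf_Suc algebra_simps add_divide_distrib del: arm_steps.simps)
    qed simp
  qed simp
  then show ?thesis using assms by (simp add: belief_def)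
qed

text \<open>
  Playing another arm whose last observation was good lowers the potential by at least \<open>1\<close> in
  expectation, since it is found bad with probability at least \<open>\<beta>\<close>.
\<close>

lemma needle_myopic_le:
  assumes \<nu>: "initial_info I \<nu>" and myopic: "myopic_policy I \<nu> \<pi>"
  shows "upper_value I \<nu> \<pi> \<le> ereal R"
proof (rule upper_value_le[where N = 0])
  define \<Phi> :: "info \<Rightarrow> real" where "\<Phi> \<kappa> = real (card {i. i < n \<and> i \<noteq> 0 \<and> fst (\<kappa> i)}) / B" for \<kappa>
  show "\<pi> \<in> policies I"
    using myopic by (rule myopic_policy_in_policies)
  show "\<bar>\<Phi> \<kappa>\<bar> \<le> real n / B" for \<kappa>
  proof -
    have "card {i. i < n \<and> i \<noteq> 0 \<and> fst (\<kappa> i)} \<le> card {..<n}" by (intro card_mono) auto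
    then show ?thesis using needle_rates by (simp add: \<Phi>_def divide_right_mono)
  qed
  fix h :: history
  let ?\<kappa> = "current_info \<nu> h"
  have age: "i < n \<Longrightarrow> 1 \<le> snd (?\<kappa> i)" for i
    using observation_age_pos[OF \<nu>, of i h] by simp
  obtain i where i: "i < n" "\<pi> h = Some i"
    and best: "\<And>j. j < n \<Longrightarrow> reward I j * belief I ?\<kappa> j \<le> reward I i * belief I ?\<kappa> i"
    using myopic_policyE[OF myopic, of h] by auto
  show "expected_gain I ?\<kappa> (\<pi> h) + expected_next I \<Phi> ?\<kappa> (\<pi> h) \<le> R + \<Phi> ?\<kappa>"
  proof (cases "i = 0")
    case True
    have "\<Phi> (observe ?\<kappa> (Some (0, s))) = \<Phi> ?\<kappa>" for s
      unfolding \<Phi>_def by (intro arg_cong[where f = "\<lambda>S. real (card S) / B"]) auto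
    then have "expected_next I \<Phi> ?\<kappa> (\<pi> h) = \<Phi> ?\<kappa>"
      using i True by (simp add: expected_next_def algebra_simps)
    moreover have "expected_gain I ?\<kappa> (\<pi> h) \<le> R"
      using i True belief_bounds[of I ?\<kappa> 0] needle_rates mult_left_mono[of "belief I ?\<kappa> 0" 1 R]
      by (simp add: expected_gain_def)
    ultimately show ?thesis by simp
  next
    case False
    \<comment> \<open>Preferring arm \<open>i\<close> to the safe arm requires a belief of at least
      \<open>2 / n\<close>, which an arm last seen bad cannot have.\<close>
    have "2 / real n \<le> R * belief I ?\<kappa> 0"
      unfolding needle_rates(7)[symmetric] using needle_rates needle_safe_belief age n by (intro mult_left_mono) auto
    also have "\<dots> \<le> belief I ?\<kappa> i"
      using best[of 0] False n by simp
    finally have good: "fst (?\<kappa> i)"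
      using needle_bad_belief_le[of i ?\<kappa>] i False n by (auto simp: field_simps)
    let ?S = "{j. j < n \<and> j \<noteq> 0 \<and> fst (?\<kappa> j)}"
    have "{j. j < n \<and> j \<noteq> 0 \<and> fst (observe ?\<kappa> (Some (i, True)) j)} = ?S"
      using good by auto
    then have T: "\<Phi> (observe ?\<kappa> (Some (i, True))) = \<Phi> ?\<kappa>"
      by (simp add: \<Phi>_def)
    have S: "{j. j < n \<and> j \<noteq> 0 \<and> fst (observe ?\<kappa> (Some (i, False)) j)} = ?S - {i}"
      using good by auto
    have "Suc (card (?S - {i})) = card ?S"
      using good i False by (intro card_Suc_Diff1) auto
    then have card: "real (card (?S - {i})) = real (card ?S) - 1" by linarith
    have F: "\<Phi> (observe ?\<kappa> (Some (i, False))) = \<Phi> ?\<kappa> - 1 / B"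
      unfolding \<Phi>_def S card by (simp add: diff_divide_distrib)
    have "B \<le> 1 - belief I ?\<kappa> i"
      using needle_belief_le[of i ?\<kappa>] i False age by simp
    \<comment> \<open>The expected loss of potential outweighs the expected reward, which is at most
      1.\<close>
    then have "1 \<le> (1 - belief I ?\<kappa> i) / B"
      using needle_rates(4) by simp
    moreover have "expected_gain I ?\<kappa> (\<pi> h) + expected_next I \<Phi> ?\<kappa> (\<pi> h)
        = belief I ?\<kappa> i + \<Phi> ?\<kappa> - (1 - belief I ?\<kappa> i) / B"
      using i False unfolding expected_gain_def expected_next_def
      by (simp add: T F algebra_simps diff_divide_distrib del: observe.simps)
    ultimately show ?thesis
      using belief_bounds[of I ?\<kappa> i] needle_rates(6) by linarith
  qed
qed

text \<open>The safe arm offers at least \<open>2 / n\<close> in every step and the myopic choice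
  earns no less, so the zero potential suffices. Positivity makes the gap a genuine ratio.\<close>

lemma needle_myopic_pos:
  assumes \<nu>: "initial_info I \<nu>" and myopic: "myopic_policy I \<nu> \<pi>"
  shows "0 < upper_value I \<nu> \<pi>"
proof -
  have "\<pi> \<in> policies I"
    using myopic by (rule myopic_policy_in_policies)
  then have "ereal (2 / real n) \<le> lower_value I \<nu> \<pi>"
  proof (rule lower_value_ge[where N = 0 and \<Phi> = "\<lambda>_. 0" and B = 0])
    fix h :: history
    let ?\<kappa> = "current_info \<nu> h"
    obtain i where i: "i < n" "\<pi> h = Some i"
      and best: "\<And>j. j < n \<Longrightarrow> reward I j * belief I ?\<kappa> j \<le> reward I i * belief I ?\<kappa> i"
      using myopic_policyE[OF myopic, of h] by auto
    have "2 / real n \<le> R * belief I ?\<kappa> 0"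
      unfolding needle_rates(7)[symmetric] using needle_rates needle_safe_belief observation_age_pos[OF \<nu>, of 0 h] n
      by (intro mult_left_mono) auto
    also have "\<dots> \<le> reward I i * belief I ?\<kappa> i"
      using best[of 0] n by simp
    finally show "2 / real n + 0 \<le> expected_gain I ?\<kappa> (\<pi> h) + expected_next I (\<lambda>_. 0) ?\<kappa> (\<pi> h)"
      using i by (simp add: expected_gain_def expected_next_def del: needle_simps)
  qed simp
  also have "\<dots> \<le> upper_value I \<nu> \<pi>"
    unfolding lower_value_def upper_value_def by (rule Liminf_le_Limsup) simp
  finally show ?thesis
    using n by (auto intro: less_le_trans[rotated])
qed

text \<open>The policy stays with an arm found good in the previous step and otherwise probes an arm
  of age at least \<open>n - 1\<close>. The potential \<open>G\<close> is the worth of holding an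
  arm just found good.\<close>

lemma needle_optimal_ge:
  assumes \<nu>: "initial_info I \<nu>"
  shows "ereal (1 / 16) \<le> optimal_value I \<nu>"
proof -
  define known where "known \<kappa> i \<longleftrightarrow> i < n \<and> i \<noteq> 0 \<and> \<kappa> i = (True, 1)" for \<kappa> :: info and i
  define stale where "stale \<kappa> i \<longleftrightarrow> i < n \<and> i \<noteq> 0 \<and> n - 1 \<le> snd (\<kappa> i)" for \<kappa> :: info and i
  define \<pi> :: policy where "\<pi> h = Some (let \<kappa> = current_info \<nu> h in
    if Ex (known \<kappa>) then Eps (known \<kappa>) else if Ex (stale \<kappa>) then Eps (stale \<kappa>) else 0)" for h
  \<comment> \<open>\<open>1 / B\<close> is the mean length of a good spell. Half of it is credited,
    so that staying costs \<open>B * G = 1 / 2\<close> of potential per step, less than the reward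
    brings in.\<close>
  define G where "G = 1 / (2 * B)"
  define \<Phi> :: "info \<Rightarrow> real" where "\<Phi> \<kappa> = (if Ex (known \<kappa>) then G else 0)" for \<kappa>
  have G: "0 < G" "B * G = 1 / 2" using needle_rates by (simp_all add: G_def)
  have \<Phi>_nonneg: "0 \<le> \<Phi> \<kappa>" for \<kappa> using G by (simp add: \<Phi>_def)
  have known_less: "known \<kappa> i \<Longrightarrow> i < n" and stale_less: "stale \<kappa> i \<Longrightarrow> i < n" for \<kappa> i
    by (simp_all add: known_def stale_def)
  have "Eps (known \<kappa>) < n" if "Ex (known \<kappa>)" for \<kappa>
    by (rule known_less[OF someI_ex[OF that]])
  moreover have "Eps (stale \<kappa>) < n" if "Ex (stale \<kappa>)" for \<kappa>
    by (rule stale_less[OF someI_ex[OF that]])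
  ultimately have policy: "\<pi> \<in> policies I"
    using n by (simp add: policies_def actions_def \<pi>_def Let_def)
  have "ereal (1 / 16) \<le> lower_value I \<nu> \<pi>"
  \<comment> \<open>The first \<open>n\<close> steps are skipped since the initial ages may all be
    small.\<close>
  proof (rule lower_value_ge[OF policy, where N = n and B = G and \<Phi> = \<Phi>])
    fix h :: history assume h: "n \<le> length h"
    let ?\<kappa> = "current_info \<nu> h"
    have gain: "belief I ?\<kappa> i * (1 + G) \<le> expected_gain I ?\<kappa> (Some i) + expected_next I \<Phi> ?\<kappa> (Some i)"
      if "i < n" "i \<noteq> 0" for i
    proof -
      have "\<Phi> (observe ?\<kappa> (Some (i, True))) = G"
        using that by (auto simp: \<Phi>_def known_def)
      moreover have "0 \<le> (1 - belief I ?\<kappa> i) * \<Phi> (observe ?\<kappa> (Some (i, False)))"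
        using belief_bounds \<Phi>_nonneg by simp
      ultimately show ?thesis
        using that by (simp add: expected_gain_def expected_next_def algebra_simps del: observe.simps)
    qed
    show "1 / 16 + \<Phi> ?\<kappa> \<le> expected_gain I ?\<kappa> (\<pi> h) + expected_next I \<Phi> ?\<kappa> (\<pi> h)"
    proof (cases "Ex (known ?\<kappa>)")
      case True
      define i where "i = Eps (known ?\<kappa>)"
      have i: "i < n" "i \<noteq> 0" "?\<kappa> i = (True, 1)" and \<pi>: "\<pi> h = Some i"
        using someI_ex[OF True, folded i_def] True by (simp_all add: known_def[of _ i] \<pi>_def i_def[symmetric] Let_def)
      then have "2 \<le> n" by linarith
      then have "B \<le> 1 / 4" using \<delta> by (simp add: B_def field_simps)
      moreover have belief: "belief I ?\<kappa> i = 1 - B"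
        using i by (simp add: belief_def needle_pmf_Suc del: arm_steps.simps) simp
      ultimately have "1 / 16 + G \<le> belief I ?\<kappa> i * (1 + G)"
        unfolding belief using G by (simp add: algebra_simps)
      also note gain[OF i(1,2)]
      finally show ?thesis
        using True by (simp add: \<pi> \<Phi>_def)
    next
      case False
      show ?thesis
      proof (cases "Ex (stale ?\<kappa>)")
        case True
        define i where "i = Eps (stale ?\<kappa>)"
        have i: "i < n" "i \<noteq> 0" "n - 1 \<le> snd (?\<kappa> i)" and \<pi>: "\<pi> h = Some i"
          using someI_ex[OF True, folded i_def] True by (simp_all add: stale_def[of _ i] \<pi>_def if_not_P[OF False] i_def[symmetric] Let_def)
        have "real n \<le> 2 * real (n - 1)" using i by linarith
        \<comment> \<open>By \<open>n * A = B\<close>, a probe with success probability at least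
          \<open>n * A / 8\<close> earns at least \<open>1 / 16\<close> in expected
          potential.\<close>
        have "1 / 16 = real n * A / 8 * G"
          using n G needle_rates by (simp add: G_def)
        also have "\<dots> \<le> real (n - 1) * A / 4 * G"
          using \<open>real n \<le> _\<close> needle_rates(1) G(1) by (intro mult_right_mono) (auto simp: field_simps)
        also have "\<dots> \<le> belief I ?\<kappa> i * G"
          using needle_belief_ge[of i "n - 1" ?\<kappa>] i G by (intro mult_right_mono) auto
        also have "\<dots> \<le> belief I ?\<kappa> i * (1 + G)"
          using belief_bounds by (simp add: algebra_simps)
        also note gain[OF i(1,2)]
        finally show ?thesis
          by (simp add: \<pi> \<Phi>_def if_not_P[OF False])
      next
        case no_stale: False
        \<comment> \<open>Without a stale arm all \<open>n - 1\<close> arms other than the safe one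
          have age at most \<open>n - 2\<close>, but at most \<open>n - 2\<close> arms can be that
          recent. For \<open>n = 1\<close> the safe arm alone is worth at least 2.\<close>
        have "n = 1"
        proof (rule ccontr)
          assume "n \<noteq> 1"
          then have "2 \<le> n" using n by linarith
          have "{1..<n} \<subseteq> {i. i < arms I \<and> snd (?\<kappa> i) \<le> n - 2}"
          proof
            fix i assume "i \<in> {1..<n}"
            then show "i \<in> {i. i < arms I \<and> snd (?\<kappa> i) \<le> n - 2}"
              using no_stale by (auto simp: stale_def dest: spec[of _ i])
          qed
          then have "card {1..<n} \<le> card {i. i < arms I \<and> snd (?\<kappa> i) \<le> n - 2}"
            by (intro card_mono) auto
          also have "\<dots> \<le> n - 2"
            using card_recently_observed[OF \<nu>, of "n - 2" h] h by simp
          finally show False using \<open>2 \<le> n\<close> by simp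
        qed
        moreover have "2 / real n \<le> R * belief I ?\<kappa> 0"
          unfolding needle_rates(7)[symmetric] using needle_rates needle_safe_belief observation_age_pos[OF \<nu>, of 0 h] n
          by (intro mult_left_mono) auto
        moreover have "0 \<le> expected_next I \<Phi> ?\<kappa> (\<pi> h)"
          using belief_bounds \<Phi>_nonneg by (auto simp: expected_next_def \<pi>_def)
        ultimately show ?thesis
          by (simp add: \<pi>_def \<Phi>_def Let_def expected_gain_def if_not_P[OF False] if_not_P[OF no_stale])
      qed
    qed
  qed (use G in \<open>auto simp: \<Phi>_def\<close>)
  then show ?thesis
    unfolding optimal_value_def by (rule order_trans[OF _ SUP_upper[OF policy]])
qed

end

text \<open>The factor is \<open>1 / 16\<close>, guaranteed to the optimum, divided by the bound
  \<open>2 / (n * (1 - \<delta>))\<close> on the myopic value.\<close>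

theorem myopic_gap:
  assumes \<delta>: "0 < \<delta>" "\<delta> < 1" and n: "1 \<le> n"
    and \<nu>: "initial_info (needle_mab \<delta> n) \<nu>" and myopic: "myopic_policy (needle_mab \<delta> n) \<nu> \<pi>"
  shows "ereal ((1 - \<delta>) / 32 * real n) * upper_value (needle_mab \<delta> n) \<nu> \<pi> \<le> optimal_value (needle_mab \<delta> n) \<nu>"
proof -
  have "ereal ((1 - \<delta>) / 32 * real n) * upper_value (needle_mab \<delta> n) \<nu> \<pi>
    \<le> ereal ((1 - \<delta>) / 32 * real n) * ereal (2 / (real n * (1 - \<delta>)))"
    using \<delta> needle_myopic_le[OF \<delta> n \<nu> myopic] by (intro ereal_mult_left_mono) auto
  also have "\<dots> = ereal (1 / 16)" using \<delta> n by simp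
  also have "\<dots> \<le> optimal_value (needle_mab \<delta> n) \<nu>" by (rule needle_optimal_ge[OF \<delta> n \<nu>])
  finally show ?thesis .
qed

section \<open>The gap of index policies\<close>

text \<open>The comparison of arm \<open>i\<close> in state \<open>x\<close> with arm
  \<open>j\<close> in state \<open>y\<close>, ties included, does not involve the other arms. Its
  loser is beaten at every history showing these two states.\<close>

lemma index_policy_excludes:
  assumes "index_policy I \<nu> \<pi>" and ij: "i < arms I" "j < arms I" "i \<noteq> j"
  shows "(\<forall>h. current_info \<nu> h i = x \<and> current_info \<nu> h j = y \<longrightarrow> \<pi> h \<noteq> Some i) \<or>
         (\<forall>h. current_info \<nu> h i = x \<and> current_info \<nu> h j = y \<longrightarrow> \<pi> h \<noteq> Some j)"
proof -
  obtain \<gamma> \<gamma>0 prio where best: "\<And>h a. a \<in> actions I - {\<pi> h} \<Longrightarrow>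
      action_index \<gamma> \<gamma>0 (current_info \<nu> h) a < action_index \<gamma> \<gamma>0 (current_info \<nu> h) (\<pi> h) \<or>
      action_index \<gamma> \<gamma>0 (current_info \<nu> h) a = action_index \<gamma> \<gamma>0 (current_info \<nu> h) (\<pi> h) \<and>
      prio a < (prio (\<pi> h) :: nat)"
    using assms(1) unfolding index_policy_def Let_def by blast
  have acts: "Some i \<in> actions I" "Some j \<in> actions I"
    using ij by (auto simp: actions_def)
  show ?thesis
  proof (cases "\<gamma> j y < \<gamma> i x \<or> \<gamma> j y = \<gamma> i x \<and> prio (Some j) < prio (Some i)")
    case True
    then have "\<pi> h \<noteq> Some j" if "current_info \<nu> h i = x" "current_info \<nu> h j = y" for h
      using best[of "Some i" h] acts ij that by (auto simp: action_index_def)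
    then show ?thesis by blast
  next
    case False
    then have "\<pi> h \<noteq> Some i" if "current_info \<nu> h i = x" "current_info \<nu> h j = y" for h
      using best[of "Some j" h] acts ij that by (auto simp: action_index_def)
    then show ?thesis by blast
  qed
qed

section \<open>The three-armed instance and its belief enclosures\<close>

text \<open>Arms 0, 1, 2 are the safe, fast and slow arm; \<open>1 - \<alpha> - \<beta>\<close> is
  \<open>3 / 20\<close> for the fast and \<open>7 / 10\<close> for the slow one. In the stationary
  law the fast arm yields \<open>14000 * 12 / 17\<close>, about 9882, close to the 10000 of the good
  safe arm.\<close>

definition trio_mab :: feedback_mab where
  "trio_mab = \<lparr>arms = 3,
     alpha = (\<lambda>i. if i = 0 then 1 / 2 else if i = 1 then 3 / 5 else 1 / 20),
     beta = (\<lambda>i. if i = 0 then 0 else 1 / 4),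
     reward = (\<lambda>i. if i = 0 then 10000 else if i = 1 then 14000 else 38000)\<rparr>"

lemma trio_mab_simps [simp]: "arms trio_mab = 3"
    "alpha trio_mab i = (if i = 0 then 1 / 2 else if i = 1 then 3 / 5 else 1 / 20)"
    "beta trio_mab i = (if i = 0 then 0 else 1 / 4)"
    "reward trio_mab i = (if i = 0 then 10000 else if i = 1 then 14000 else 38000)"
  by (simp_all add: trio_mab_def)

lemma is_feedback_trio_mab: "is_feedback_mab (1 / 10) trio_mab"
  by (auto simp: is_feedback_mab_def)

text \<open>
  Observations that are old are lumped together: \<open>b\<close> classes for arms last seen bad, followed by
  \<open>g\<close> classes for arms last seen good.
\<close>

definition info_class :: "nat \<Rightarrow> nat \<Rightarrow> bool \<times> nat \<Rightarrow> nat" where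
  "info_class b g = (\<lambda>(s, t). if s then b + min t g - 1 else min t b - 1)"

definition next_class :: "nat \<Rightarrow> nat \<Rightarrow> nat \<Rightarrow> nat" where
  "next_class b g c = (if c < b then min (Suc c) (b - 1) else min (Suc c) (b + g - 1))"

lemma info_class_Suc:
  assumes "1 \<le> t" "1 \<le> b" "1 \<le> g"
  shows "info_class b g (s, Suc t) = next_class b g (info_class b g (s, t))"
  using assms by (auto simp: info_class_def next_class_def min_def)

lemma info_class_1: "1 \<le> b \<Longrightarrow> 1 \<le> g \<Longrightarrow> info_class b g (s, Suc 0) = (if s then b else 0)"
  by (auto simp: info_class_def)

lemma info_class_less: "1 \<le> b \<Longrightarrow> 1 \<le> g \<Longrightarrow> info_class b g x < b + g"
  by (auto simp: info_class_def split: prod.splits)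

text \<open>
  Beliefs are enclosed in units of \<open>1/100000\<close>. The rates \<open>a\<close> for \<open>\<alpha>\<close> and \<open>l\<close> for
  \<open>1 - \<alpha> - \<beta>\<close> are given in percent.
\<close>

definition enclosure_ok :: "nat \<Rightarrow> nat \<Rightarrow> int \<Rightarrow> int \<Rightarrow> int list \<Rightarrow> int list \<Rightarrow> bool" where
  "enclosure_ok b g a l low high \<longleftrightarrow>
     100 * low ! 0 \<le> 100000 * a \<and> 100000 * a \<le> 100 * high ! 0 \<and>
     100 * low ! b \<le> 100000 * (a + l) \<and> 100000 * (a + l) \<le> 100 * high ! b \<and>
     (\<forall>c\<in>{..<b + g}. 100 * low ! next_class b g c \<le> 100000 * a + l * low ! c \<and>
        100000 * a + l * high ! c \<le> 100 * high ! next_class b g c)"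

text \<open>As \<open>0 \<le> l\<close>, the recursion is monotone and maps the enclosure of a class
  into that of its successor. Finitely many integer checks thus cover all ages.\<close>

lemma enclosure:
  assumes ok: "enclosure_ok b g a l low high" and bg: "1 \<le> b" "1 \<le> g" and l: "0 \<le> l"
    and start: "\<And>s. f s 0 = (if s then 1 else 0)"
    and recursion: "\<And>s t. f s (Suc t) = (of_int a + of_int l * f s t) / (100 :: real)"
    and t: "1 \<le> t"
  shows "of_int (low ! info_class b g (s, t)) \<le> 100000 * f s t \<and>
    100000 * f s t \<le> of_int (high ! info_class b g (s, t))"
proof -
  let ?c = "\<lambda>t. info_class b g (s, t)"
  have base: "100 * low ! ?c 1 \<le> 100000 * (a + (if s then l else 0))"
    "100000 * (a + (if s then l else 0)) \<le> 100 * high ! ?c 1"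
    using ok bg by (simp_all add: enclosure_ok_def info_class_1)
  show ?thesis
    using t
  proof (induction t rule: dec_induct)
    case base
    have f: "100000 * f s 1 * 100 = of_int (100000 * (a + (if s then l else 0)))"
      by (simp add: recursion start)
    have "of_int (100 * low ! ?c 1) \<le> 100000 * f s 1 * 100" "100000 * f s 1 * 100 \<le> of_int (100 * high ! ?c 1)"
      unfolding f using \<open>100 * low ! ?c 1 \<le> _\<close> \<open>_ \<le> 100 * high ! ?c 1\<close> by (simp_all only: of_int_le_iff)
    then show ?case by simp
  next
    case (step t)
    let ?c' = "next_class b g (?c t)"
    have "?c t \<in> {..<b + g}" using info_class_less[OF bg] by simp
    then have *: "100 * low ! ?c' \<le> 100000 * a + l * low ! ?c t"
      "100000 * a + l * high ! ?c t \<le> 100 * high ! ?c'"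
      using ok unfolding enclosure_ok_def by blast+
    have f: "100 * (100000 * f s (Suc t)) = 100000 * of_int a + of_int l * (100000 * f s t)"
      by (simp add: recursion algebra_simps)
    have real: "real_of_int (100 * low ! ?c') \<le> of_int (100000 * a + l * low ! ?c t)"
      "real_of_int (100000 * a + l * high ! ?c t) \<le> of_int (100 * high ! ?c')"
      using * by (simp_all only: of_int_le_iff)
    have "real_of_int (100 * low ! ?c') \<le> 100000 * of_int a + of_int l * of_int (low ! ?c t)"
      using real(1) by simp
    also have "\<dots> \<le> 100 * (100000 * f s (Suc t))"
      unfolding f using step.IH l by (intro add_left_mono mult_left_mono) auto
    finally have low: "real_of_int (100 * low ! ?c') \<le> 100 * (100000 * f s (Suc t))" .
    have "100 * (100000 * f s (Suc t)) \<le> 100000 * of_int a + of_int l * of_int (high ! ?c t)"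
      unfolding f using step.IH l by (intro add_left_mono mult_left_mono) auto
    also have "\<dots> \<le> of_int (100 * high ! ?c')"
      using real(2) by simp
    finally show ?case
      using low step.hyps bg by (simp add: info_class_Suc)
  qed
qed

text \<open>The left-hand side is affine in \<open>x\<close>, so the two ends of the enclosure are
  the worst cases.\<close>

lemma convex_combination_le:
  fixes x G Z V :: real
  assumes "low \<le> P * x" "P * x \<le> high"
    and "low * G + (P - low) * Z \<le> V" "high * G + (P - high) * Z \<le> V"
  shows "P * (x * G + (1 - x) * Z) \<le> V"
proof (cases "Z \<le> G")
  case True
  then have "(P * x) * (G - Z) \<le> high * (G - Z)" using assms by (intro mult_right_mono) auto
  then show ?thesis using assms by (simp add: algebra_simps)
next
  case False
  then have "(P * x) * (G - Z) \<le> low * (G - Z)" using assms by (intro mult_right_mono_neg) auto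
  then show ?thesis using assms by (simp add: algebra_simps)
qed

section \<open>Numerical certificates\<close>

text \<open>Ages 1, 2, 3 and at least 4 after a bad observation, then ages 1, 2 and at least 3 after
  a good one.\<close>

definition fast_low :: "int list" where
  "fast_low = [60000, 69000, 70350, 70552, 75000, 71250, 70588]"

definition fast_high :: "int list" where
  "fast_high = [60000, 69000, 70350, 70589, 75000, 71250, 70688]"

text \<open>Ages 1 to 8 and at least 9 after a bad observation, then age 1 and at least 2 after a
  good one. The last class is coarse: it reaches from the stationary belief \<open>1 / 6\<close> up
  to \<open>0.575\<close>.\<close>

definition slow_low :: "int list" where
  "slow_low = [5000, 8500, 10950, 12665, 13865, 14705, 15293, 15705, 15993, 75000, 16666]"

definition slow_high :: "int list" where
  "slow_high = [5000, 8500, 10950, 12665, 13866, 14707, 15295, 15707, 16667, 75000, 57500]"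

text \<open>
  Rows are the classes of the fast arm, with an extra row \<open>7\<close> for the contested situation (safe arm
  \<open>(True, 1)\<close>, fast arm \<open>(False, 2)\<close>); columns are the classes of the slow arm. The tables are
  relative values computed by value iteration, with every belief replaced by the worst end of its
  enclosure, and rounded: for the unrestricted problem, and for the problems where the
  safe or the fast arm may not be played in row \<open>7\<close>.
\<close>

definition optimal_table :: "int list list" where
  "optimal_table = [
    [0, 902, 1931, 3041, 4001, 4905, 5539, 5982, 6292, 69831, 7017],
    [208, 1137, 2039, 3067, 4178, 5081, 5713, 6156, 6465, 69888, 7189],
    [412, 1339, 2237, 3067, 4204, 5107, 5739, 6181, 6491, 69896, 7214],
    [443, 1369, 2267, 3085, 4204, 5107, 5739, 6181, 6491, 69896, 7214],
    [1116, 2036, 2920, 3729, 4488, 5198, 5829, 6271, 6580, 69926, 7303],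
    [548, 1474, 2370, 3186, 4210, 5112, 5744, 6187, 6496, 69901, 7219],
    [448, 1375, 2272, 3090, 4210, 5112, 5744, 6187, 6496, 69901, 7219],
    [208, 1137, 2039, 3067, 4178, 5081, 5713, 6156, 6465, 69888, 7189]]"

definition table_without_safe :: "int list list" where
  "table_without_safe = [
    [0, 956, 1790, 3081, 4036, 4942, 5575, 6092, 7053, 69880, 51031],
    [234, 1154, 2088, 3112, 4213, 5117, 5749, 6192, 7224, 69937, 51123],
    [438, 1337, 2286, 3112, 4244, 5148, 5780, 6222, 7254, 69946, 51139],
    [474, 1373, 2321, 3135, 4244, 5148, 5780, 6222, 7254, 69946, 51139],
    [1139, 2043, 2969, 3775, 4530, 5235, 5868, 6636, 7340, 69982, 51189],
    [573, 1473, 2418, 3231, 4259, 5163, 5795, 6237, 7269, 69961, 51153],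
    [489, 1388, 2336, 3150, 4259, 5163, 5795, 6237, 7269, 69961, 51153],
    [234, 1132, 2088, 2922, 4213, 5117, 5749, 6192, 7224, 69937, 51123]]"

definition table_without_fast :: "int list list" where
  "table_without_fast = [
    [0, 820, 1953, 3055, 4034, 4940, 5573, 6066, 7050, 69859, 51016],
    [237, 1168, 2067, 3086, 4188, 5092, 5724, 6167, 7199, 69910, 51096],
    [414, 1370, 2266, 3086, 4219, 5123, 5755, 6197, 7229, 69919, 51112],
    [450, 1406, 2301, 3120, 4219, 5123, 5755, 6197, 7229, 69919, 51112],
    [1123, 2068, 2950, 3758, 4510, 5211, 5846, 6616, 7316, 69955, 51163],
    [551, 1505, 2398, 3215, 4234, 5138, 5770, 6213, 7244, 69934, 51127],
    [465, 1421, 2315, 3134, 4234, 5138, 5770, 6213, 7244, 69934, 51127],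
    [237, 1133, 1953, 3086, 4188, 5092, 5724, 6167, 7199, 69910, 51096]]"

text \<open>In row \<open>7\<close> the fast arm is in class 1, so its next class is 2.\<close>

definition next_row :: "nat \<Rightarrow> nat" where
  "next_row r = (if r = 7 then 2 else next_class 4 3 r)"

definition mix :: "int \<Rightarrow> int \<Rightarrow> int \<Rightarrow> int" where
  "mix p x y = p * x + (100000 - p) * y"

text \<open>The drift inequality for the bound 11134, multiplied by 100000 and tested for idling and
  for each arm, except arm \<open>k\<close> in row \<open>7\<close>. The test of the safe arm takes
  it to be good; a failed play is covered by the test of idling.\<close>

definition upper_ok :: "int list list \<Rightarrow> nat \<Rightarrow> nat \<Rightarrow> nat \<Rightarrow> bool" where
  "upper_ok H k r c \<longleftrightarrow> (let V = 100000 * (11134 + H ! r ! c); b = (if r = 7 then 1 else r);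
       r' = next_row r; c' = next_class 9 2 c in
     100000 * H ! r' ! c' \<le> V \<and>
     (k = 0 \<and> r = 7 \<or> 100000 * (10000 + H ! (if r = 0 then 7 else r') ! c') \<le> V) \<and>
     (k = 1 \<and> r = 7 \<or> (\<forall>p\<in>{fast_low ! b, fast_high ! b}. mix p (14000 + H ! 4 ! c') (H ! 0 ! c') \<le> V)) \<and>
     (\<forall>p\<in>{slow_low ! c, slow_high ! c}. mix p (38000 + H ! r' ! 9) (H ! r' ! 0) \<le> V))"

definition lower_ok :: "int list list \<Rightarrow> nat \<Rightarrow> nat \<Rightarrow> bool" where
  "lower_ok H r c \<longleftrightarrow> (let V = 100000 * (11136 + H ! r ! c); b = (if r = 7 then 1 else r);
       r' = next_row r; c' = next_class 9 2 c in
     0 \<le> H ! r ! c \<and>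
     (V \<le> 100000 * (10000 + H ! (if r = 0 then 7 else r') ! c') \<or>
      (\<forall>p\<in>{fast_low ! b, fast_high ! b}. V \<le> mix p (14000 + H ! 4 ! c') (H ! 0 ! c')) \<or>
      (\<forall>p\<in>{slow_low ! c, slow_high ! c}. V \<le> mix p (38000 + H ! r' ! 9) (H ! r' ! 0))))"

lemma fast_enclosure_ok: "enclosure_ok 4 3 60 15 fast_low fast_high"
  by code_simp

lemma slow_enclosure_ok: "enclosure_ok 9 2 5 70 slow_low slow_high"
  by code_simp

lemma table_without_safe_ok: "\<forall>r\<in>{..<8}. \<forall>c\<in>{..<11}. upper_ok table_without_safe 0 r c"
  by code_simp

lemma table_without_fast_ok: "\<forall>r\<in>{..<8}. \<forall>c\<in>{..<11}. upper_ok table_without_fast 1 r c"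
  by code_simp

lemma optimal_table_ok: "\<forall>r\<in>{..<8}. \<forall>c\<in>{..<11}. lower_ok optimal_table r c"
  by code_simp

section \<open>From the tables to drift inequalities\<close>

definition table_row :: "info \<Rightarrow> nat" where
  "table_row \<kappa> = (if \<kappa> 0 = (True, 1) \<and> \<kappa> 1 = (False, 2) then 7 else info_class 4 3 (\<kappa> 1))"

definition table_column :: "info \<Rightarrow> nat" where
  "table_column \<kappa> = info_class 9 2 (\<kappa> 2)"

lemma table_row_less: "table_row \<kappa> < 8"
  using info_class_less[of 4 3 "\<kappa> 1"] by (simp add: table_row_def)

lemma table_column_less: "table_column \<kappa> < 11"
  using info_class_less[of 9 2 "\<kappa> 2"] by (simp add: table_column_def)

lemma table_row_class: "(if table_row \<kappa> = 7 then 1 else table_row \<kappa>) = info_class 4 3 (\<kappa> 1)"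
  using info_class_less[of 4 3 "\<kappa> 1"] by (auto simp: table_row_def info_class_def)

definition seen :: "info \<Rightarrow> bool" where
  "seen \<kappa> \<longleftrightarrow> (\<forall>i<3. 1 \<le> snd (\<kappa> i))"

text \<open>Row \<open>7\<close> arises exactly when the safe arm is found good one step after the
  fast arm was found bad, that is from row \<open>0\<close>. Rows therefore evolve without further
  knowledge of the safe arm.\<close>

lemma table_row_observe:
  assumes "seen \<kappa>"
  shows "table_row (observe \<kappa> None) = next_row (table_row \<kappa>)"
    "table_row (observe \<kappa> (Some (0, True))) = (if table_row \<kappa> = 0 then 7 else next_row (table_row \<kappa>))"
    "table_row (observe \<kappa> (Some (0, False))) = next_row (table_row \<kappa>)"
    "table_row (observe \<kappa> (Some (Suc 0, s))) = (if s then 4 else 0)"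
    "table_row (observe \<kappa> (Some (2, s))) = next_row (table_row \<kappa>)"
proof -
  obtain s0 t0 s1 t1 where \<kappa>: "\<kappa> 0 = (s0, t0)" "\<kappa> 1 = (s1, t1)" by fastforce
  have t: "1 \<le> t0" "1 \<le> t1"
    using assms \<kappa> by (auto simp: seen_def dest: spec[of _ 0] spec[of _ 1])
  have next_class: "next_row (table_row \<kappa>) = info_class 4 3 (s1, Suc t1)"
  proof (cases "table_row \<kappa> = 7")
    case True
    then show ?thesis using \<kappa> info_class_less[of 4 3 "\<kappa> 1"]
      by (auto simp: table_row_def next_row_def info_class_def split: if_splits)
  next
    case False
    then show ?thesis using t \<kappa> by (auto simp: table_row_def next_row_def info_class_Suc)
  qed
  have zero: "table_row \<kappa> = 0 \<longleftrightarrow> \<not> s1 \<and> t1 = 1"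
    using t \<kappa> by (auto simp: table_row_def info_class_def)
  show "table_row (observe \<kappa> None) = next_row (table_row \<kappa>)" "table_row (observe \<kappa> (Some (0, False))) = next_row (table_row \<kappa>)"
    "table_row (observe \<kappa> (Some (2, s))) = next_row (table_row \<kappa>)"
    unfolding next_class using t \<kappa> by (auto simp: table_row_def)
  show "table_row (observe \<kappa> (Some (0, True))) = (if table_row \<kappa> = 0 then 7 else next_row (table_row \<kappa>))"
    unfolding next_class zero using t \<kappa> by (auto simp: table_row_def)
  show "table_row (observe \<kappa> (Some (Suc 0, s))) = (if s then 4 else 0)"
    using t \<kappa> by (auto simp: table_row_def info_class_1)
qed

lemma table_column_observe:
  assumes "seen \<kappa>"
  shows "table_column (observe \<kappa> None) = next_class 9 2 (table_column \<kappa>)"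
    "i \<noteq> 2 \<Longrightarrow> table_column (observe \<kappa> (Some (i, s))) = next_class 9 2 (table_column \<kappa>)"
    "table_column (observe \<kappa> (Some (2, s))) = (if s then 9 else 0)"
  using assms by (auto simp: table_column_def seen_def info_class_1 info_class_Suc)

lemma trio_pmf_Suc:
  "i < 3 \<Longrightarrow> pmf (arm_steps trio_mab i s (Suc t)) True = alpha trio_mab i
     + (1 - alpha trio_mab i - beta trio_mab i) * pmf (arm_steps trio_mab i s t) True"
  by (rule pmf_arm_steps_Suc[OF is_feedback_trio_mab]) simp

lemma safe_belief: "fst (\<kappa> 0) \<Longrightarrow> belief trio_mab \<kappa> 0 = 1"
  "seen \<kappa> \<Longrightarrow> 1 / 2 \<le> belief trio_mab \<kappa> 0"
proof -
  have "pmf (arm_steps trio_mab 0 True t) True = 1" for t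
    by (induction t) (simp_all add: trio_pmf_Suc del: arm_steps.simps(2))
  then show "belief trio_mab \<kappa> 0 = 1" if "fst (\<kappa> 0)" using that by (simp add: belief_def)
  show "1 / 2 \<le> belief trio_mab \<kappa> 0" if "seen \<kappa>"
  proof -
    have "1 \<le> snd (\<kappa> 0)" using that by (simp add: seen_def)
    then obtain t where "snd (\<kappa> 0) = Suc t" by (cases "snd (\<kappa> 0)") auto
    then show ?thesis by (simp add: belief_def trio_pmf_Suc del: arm_steps.simps)
  qed
qed

lemma fast_belief:
  assumes "seen \<kappa>"
  defines "b \<equiv> (if table_row \<kappa> = 7 then 1 else table_row \<kappa>)"
  shows "of_int (fast_low ! b) \<le> 100000 * belief trio_mab \<kappa> 1"
    "100000 * belief trio_mab \<kappa> 1 \<le> of_int (fast_high ! b)"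
  using enclosure[OF fast_enclosure_ok, of "\<lambda>s t. pmf (arm_steps trio_mab 1 s t) True" "snd (\<kappa> 1)" "fst (\<kappa> 1)"]
    assms(1) unfolding b_def table_row_class
  by (simp_all add: seen_def belief_def trio_pmf_Suc field_simps del: arm_steps.simps(2))

lemma slow_belief:
  assumes "seen \<kappa>"
  shows "of_int (slow_low ! table_column \<kappa>) \<le> 100000 * belief trio_mab \<kappa> 2"
    "100000 * belief trio_mab \<kappa> 2 \<le> of_int (slow_high ! table_column \<kappa>)"
  using enclosure[OF slow_enclosure_ok, of "\<lambda>s t. pmf (arm_steps trio_mab 2 s t) True" "snd (\<kappa> 2)" "fst (\<kappa> 2)"]
    assms(1) unfolding table_column_def
  by (simp_all add: seen_def belief_def trio_pmf_Suc field_simps del: arm_steps.simps(2))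

definition entry :: "int list list \<Rightarrow> info \<Rightarrow> real" where
  "entry H \<kappa> = of_int (H ! table_row \<kappa> ! table_column \<kappa>)"

lemma entry_bounded: obtains B where "\<And>\<kappa>. \<bar>entry H \<kappa>\<bar> \<le> B"
proof
  fix \<kappa>
  show "\<bar>entry H \<kappa>\<bar> \<le> Max ((\<lambda>(r, c). \<bar>real_of_int (H ! r ! c)\<bar>) ` ({..<8} \<times> {..<11}))"
    by (rule Max_ge, simp, rule image_eqI[of _ _ "(table_row \<kappa>, table_column \<kappa>)"])
       (simp_all add: entry_def table_row_less table_column_less)
qed

lemma mix_le_lift:
  "mix p x y \<le> 100000 * v \<Longrightarrow> of_int p * of_int x + (100000 - of_int p) * of_int y \<le> 100000 * real_of_int v"
  "100000 * v \<le> mix p x y \<Longrightarrow> 100000 * real_of_int v \<le> of_int p * of_int x + (100000 - of_int p) * of_int y"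
  unfolding mix_def by (simp_all flip: of_int_le_iff[where 'a = real])

text \<open>The tests treat both ends of each belief enclosure; \<open>convex_combination_le\<close>
  extends them to the true belief. In row \<open>7\<close> the untested arm \<open>k\<close> is
  ruled out by assumption.\<close>

lemma trio_upper_step:
  assumes seen: "seen \<kappa>" and ok: "\<forall>r\<in>{..<8}. \<forall>c\<in>{..<11}. upper_ok H k r c"
    and a: "a \<in> actions trio_mab" and k: "k \<in> {0, 1}" "table_row \<kappa> = 7 \<Longrightarrow> a \<noteq> Some k"
  shows "expected_gain trio_mab \<kappa> a + expected_next trio_mab (entry H) \<kappa> a \<le> 11134 + entry H \<kappa>"
proof -
  define r c where "r = table_row \<kappa>" and "c = table_column \<kappa>"
  define r' c' where "r' = next_row r" and "c' = next_class 9 2 c"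
  define b where "b = (if r = 7 then 1 else r)"
  define v where "v = 11134 + H ! r ! c"
  have v: "11134 + entry H \<kappa> = of_int v"
    by (simp add: v_def entry_def r_def c_def)
  have "upper_ok H k r c"
    using ok table_row_less table_column_less by (simp add: r_def c_def)
  then have checks: "100000 * H ! r' ! c' \<le> 100000 * v"
    "k = 0 \<and> r = 7 \<or> 100000 * (10000 + H ! (if r = 0 then 7 else r') ! c') \<le> 100000 * v"
    "k = 1 \<and> r = 7 \<or> (\<forall>p\<in>{fast_low ! b, fast_high ! b}.
       mix p (14000 + H ! 4 ! c') (H ! 0 ! c') \<le> 100000 * v)"
    "\<forall>p\<in>{slow_low ! c, slow_high ! c}. mix p (38000 + H ! r' ! 9) (H ! r' ! 0) \<le> 100000 * v"
    unfolding upper_ok_def Let_def r'_def c'_def b_def v_def by blast+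
  have idle: "real_of_int (H ! r' ! c') \<le> of_int v"
    using checks(1) by simp
  note obs = table_row_observe[OF seen, folded r_def] table_column_observe[OF seen, folded c_def]
  consider "a = None" | "a = Some 0" | "a = Some 1" | "a = Some 2"
    using a by (auto simp: actions_def numeral_3_eq_3 less_Suc_eq)
  then show ?thesis
  proof cases
    case 1
    then show ?thesis
      unfolding v using idle
      by (simp add: expected_gain_def expected_next_def entry_def obs r'_def c'_def del: observe.simps)
  next
    case 2
    let ?x = "belief trio_mab \<kappa> 0"
    have "\<not> (k = 0 \<and> r = 7)" using k(2) 2 by (auto simp: r_def)
    then have "100000 * (10000 + H ! (if r = 0 then 7 else r') ! c') \<le> 100000 * v"
      using checks(2) by blast
    then have "10000 + H ! (if r = 0 then 7 else r') ! c' \<le> v"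
      by (simp only: mult_le_cancel_left_pos zero_less_numeral)
    then have "real_of_int (10000 + H ! (if r = 0 then 7 else r') ! c') \<le> of_int v"
      by (simp only: of_int_le_iff)
    then have "10000 + entry H (observe \<kappa> (Some (0, True))) \<le> of_int v"
      by (simp add: entry_def obs r'_def c'_def split: if_splits del: observe.simps)
    \<comment> \<open>A failed play of the safe arm leads to the same cell as idling.\<close>
    moreover have "entry H (observe \<kappa> (Some (0, False))) \<le> of_int v"
      using idle by (simp add: entry_def obs r'_def c'_def del: observe.simps)
    ultimately have "?x * (10000 + entry H (observe \<kappa> (Some (0, True))))
        + (1 - ?x) * entry H (observe \<kappa> (Some (0, False))) \<le> of_int v"
      by (rule convex_bound_le) (simp_all add: belief_bounds)
    then show ?thesis
      unfolding v by (simp add: 2 expected_gain_def expected_next_def algebra_simps del: observe.simps)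
  next
    case 3
    let ?x = "belief trio_mab \<kappa> 1"
    have "\<not> (k = 1 \<and> r = 7)" using k(2) 3 by (auto simp: r_def)
    then have "\<forall>p\<in>{fast_low ! b, fast_high ! b}. mix p (14000 + H ! 4 ! c') (H ! 0 ! c') \<le> 100000 * v"
      using checks(3) by blast
    note m = mix_le_lift(1)[OF this[rule_format]]
    have "100000 * (?x * of_int (14000 + H ! 4 ! c') + (1 - ?x) * of_int (H ! 0 ! c')) \<le> 100000 * of_int v"
      by (rule convex_combination_le[OF fast_belief[OF seen, folded r_def, folded b_def] m m]) auto
    then show ?thesis
      unfolding v by (simp add: 3 expected_gain_def expected_next_def entry_def obs c'_def algebra_simps del: observe.simps)
  next
    case 4
    let ?x = "belief trio_mab \<kappa> 2"
    note m = mix_le_lift(1)[OF checks(4)[rule_format]]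
    have "100000 * (?x * of_int (38000 + H ! r' ! 9) + (1 - ?x) * of_int (H ! r' ! 0)) \<le> 100000 * of_int v"
      by (rule convex_combination_le[OF slow_belief[OF seen, folded c_def] m m]) auto
    then show ?thesis
      unfolding v by (simp add: 4 expected_gain_def expected_next_def entry_def obs r'_def algebra_simps del: observe.simps)
  qed
qed

text \<open>
  Only the initial information can have the safe arm last seen bad. It is then played until it is good;
  the penalty \<open>22272 = 2 * 11136\<close> pays for the lost rewards, as each try succeeds with probability
  at least \<open>1 / 2\<close>.
\<close>

definition lower_potential :: "info \<Rightarrow> real" where
  "lower_potential \<kappa> = (if fst (\<kappa> 0) then entry optimal_table \<kappa> else - 22272)"

text \<open>Once the safe arm has been seen good it stays good, and \<open>lower_ok\<close> supplies
  an action for each cell; before that, the safe arm is tried.\<close>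

lemma trio_lower_step:
  assumes seen: "seen \<kappa>"
  shows "\<exists>a\<in>actions trio_mab. 11136 + lower_potential \<kappa> \<le> expected_gain trio_mab \<kappa> a + expected_next trio_mab lower_potential \<kappa> a"
proof -
  let ?H = optimal_table
  have nonneg: "0 \<le> entry ?H \<kappa>'" for \<kappa>'
    using optimal_table_ok table_row_less table_column_less by (simp add: entry_def lower_ok_def Let_def)
  note obs = table_row_observe[OF seen] table_column_observe[OF seen]
  show ?thesis
  proof (cases "fst (\<kappa> 0)")
    case False
    let ?x = "belief trio_mab \<kappa> 0"
    have "0 \<le> ?x * entry ?H (observe \<kappa> (Some (0, True)))"
      using belief_bounds nonneg by simp
    then have "11136 + lower_potential \<kappa> \<le> expected_gain trio_mab \<kappa> (Some 0) + expected_next trio_mab lower_potential \<kappa> (Some 0)"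
      using False safe_belief(2)[OF seen] by (simp add: lower_potential_def expected_gain_def expected_next_def algebra_simps)
    then show ?thesis by (intro bexI[of _ "Some 0"]) (simp_all add: actions_def)
  next
    case True
    define r c where "r = table_row \<kappa>" and "c = table_column \<kappa>"
    define r' c' where "r' = next_row r" and "c' = next_class 9 2 c"
    define b where "b = (if r = 7 then 1 else r)"
    define v where "v = 11136 + ?H ! r ! c"
    have v: "11136 + lower_potential \<kappa> = of_int v"
      using True by (simp add: lower_potential_def v_def entry_def r_def c_def)
    note obs = obs[folded r_def c_def]
    have potential_obs: "lower_potential (observe \<kappa> (Some (0, True))) = entry ?H (observe \<kappa> (Some (0, True)))"
      "lower_potential (observe \<kappa> (Some (Suc 0, s))) = entry ?H (observe \<kappa> (Some (Suc 0, s)))"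
      "lower_potential (observe \<kappa> (Some (2, s))) = entry ?H (observe \<kappa> (Some (2, s)))" for s
      using True by (simp_all add: lower_potential_def)
    have "lower_ok ?H r c"
      using optimal_table_ok table_row_less table_column_less by (simp add: r_def c_def)
    then consider "100000 * v \<le> 100000 * (10000 + ?H ! (if r = 0 then 7 else r') ! c')"
      | "\<forall>p\<in>{fast_low ! b, fast_high ! b}. 100000 * v \<le> mix p (14000 + ?H ! 4 ! c') (?H ! 0 ! c')"
      | "\<forall>p\<in>{slow_low ! c, slow_high ! c}. 100000 * v \<le> mix p (38000 + ?H ! r' ! 9) (?H ! r' ! 0)"
      unfolding lower_ok_def Let_def r'_def c'_def b_def v_def by blast
    then show ?thesis
    proof cases
      case 1
      then have "v \<le> 10000 + ?H ! (if r = 0 then 7 else r') ! c'"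
        by (simp only: mult_le_cancel_left_pos zero_less_numeral)
      then have "real_of_int v \<le> of_int (10000 + ?H ! (if r = 0 then 7 else r') ! c')"
        by (simp only: of_int_le_iff)
      \<comment> \<open>The belief in the safe arm is 1, so the outcome \<open>False\<close> has
        weight 0.\<close>
      then have "11136 + lower_potential \<kappa> \<le> expected_gain trio_mab \<kappa> (Some 0) + expected_next trio_mab lower_potential \<kappa> (Some 0)"
        unfolding v using safe_belief(1)[of \<kappa>] True
        by (simp add: expected_gain_def expected_next_def potential_obs entry_def obs r'_def c'_def
            split: if_splits del: observe.simps)
      then show ?thesis by (intro bexI[of _ "Some 0"]) (simp_all add: actions_def)
    next
      case 2
      let ?x = "belief trio_mab \<kappa> 1"
      note m = mix_le_lift(2)[OF 2[rule_format]]
      \<comment> \<open>Negation turns the upper bound of \<open>convex_combination_le\<close> into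
        the lower bound required here.\<close>
      have "100000 * (?x * - of_int (14000 + ?H ! 4 ! c') + (1 - ?x) * - of_int (?H ! 0 ! c')) \<le> - (100000 * of_int v)"
        by (rule convex_combination_le[OF fast_belief[OF seen, folded r_def, folded b_def]])
           (use m[of "fast_low ! b"] m[of "fast_high ! b"] in \<open>simp_all add: algebra_simps\<close>)
      then have "11136 + lower_potential \<kappa> \<le> expected_gain trio_mab \<kappa> (Some 1) + expected_next trio_mab lower_potential \<kappa> (Some 1)"
        unfolding v
        by (simp add: expected_gain_def expected_next_def potential_obs entry_def obs r'_def c'_def algebra_simps
            del: observe.simps)
      then show ?thesis by (intro bexI[of _ "Some 1"]) (simp_all add: actions_def)
    next
      case 3
      let ?x = "belief trio_mab \<kappa> 2"
      note m = mix_le_lift(2)[OF 3[rule_format]]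
      have "100000 * (?x * - of_int (38000 + ?H ! r' ! 9) + (1 - ?x) * - of_int (?H ! r' ! 0)) \<le> - (100000 * of_int v)"
        by (rule convex_combination_le[OF slow_belief[OF seen, folded c_def]])
           (use m[of "slow_low ! c"] m[of "slow_high ! c"] in \<open>simp_all add: algebra_simps\<close>)
      then have "11136 + lower_potential \<kappa> \<le> expected_gain trio_mab \<kappa> (Some 2) + expected_next trio_mab lower_potential \<kappa> (Some 2)"
        unfolding v
        by (simp add: expected_gain_def expected_next_def potential_obs entry_def obs r'_def c'_def algebra_simps
            del: observe.simps)
      then show ?thesis by (intro bexI[of _ "Some 2"]) (simp_all add: actions_def)
    qed
  qed
qed

lemma seen_current_info: "initial_info trio_mab \<nu> \<Longrightarrow> seen (current_info \<nu> h)"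
  using observation_age_pos[of trio_mab \<nu> _ h] by (simp add: seen_def)

text \<open>Choosing for every history an action that satisfies the lower drift inequality yields a
  policy, which need not be described explicitly.\<close>

lemma trio_optimal_ge:
  assumes "initial_info trio_mab \<nu>"
  shows "ereal 11136 \<le> optimal_value trio_mab \<nu>"
proof -
  obtain B where B: "\<bar>entry optimal_table \<kappa>\<bar> \<le> B" for \<kappa>
    by (rule entry_bounded[of optimal_table]) blast
  have "\<forall>h. \<exists>a. a \<in> actions trio_mab \<and> 11136 + lower_potential (current_info \<nu> h)
      \<le> expected_gain trio_mab (current_info \<nu> h) a + expected_next trio_mab lower_potential (current_info \<nu> h) a"
    using trio_lower_step[OF seen_current_info[OF assms]] by blast
  from choice[OF this] obtain \<pi> where \<pi>: "\<And>h. \<pi> h \<in> actions trio_mab"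
    "\<And>h. 11136 + lower_potential (current_info \<nu> h) \<le> expected_gain trio_mab (current_info \<nu> h) (\<pi> h)
        + expected_next trio_mab lower_potential (current_info \<nu> h) (\<pi> h)"
    by blast
  have policy: "\<pi> \<in> policies trio_mab" using \<pi>(1) by (simp add: policies_def)
  have "ereal 11136 \<le> lower_value trio_mab \<nu> \<pi>"
  proof (rule lower_value_ge[OF policy, where N = 0 and \<Phi> = lower_potential])
    show "\<bar>lower_potential \<kappa>\<bar> \<le> max B 22272" for \<kappa>
      using B[of \<kappa>] by (auto simp: lower_potential_def)
  qed (rule \<pi>(2))
  then show ?thesis
    unfolding optimal_value_def by (rule order_trans[OF _ SUP_upper[OF policy]])
qed

text \<open>With the safe arm just found good and the fast arm found bad two steps ago, one of the
  two is never played. Each alternative has its own table, and both certify the same bound.\<close>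

lemma trio_index_le:
  assumes \<nu>: "initial_info trio_mab \<nu>" and index: "index_policy trio_mab \<nu> \<pi>"
  shows "upper_value trio_mab \<nu> \<pi> \<le> ereal 11134"
proof -
  have \<pi>: "\<pi> \<in> policies trio_mab"
    using index unfolding index_policy_def policies_def by blast
  have le: "upper_value trio_mab \<nu> \<pi> \<le> ereal 11134"
    if ok: "\<forall>r\<in>{..<8}. \<forall>c\<in>{..<11}. upper_ok H k r c" and k: "k \<in> {0, 1}"
      and avoid: "\<And>h. current_info \<nu> h 0 = (True, 1) \<Longrightarrow> current_info \<nu> h 1 = (False, 2) \<Longrightarrow> \<pi> h \<noteq> Some k" for H k
  proof -
    obtain B where B: "\<bar>entry H \<kappa>\<bar> \<le> B" for \<kappa> by (rule entry_bounded[of H]) blast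
    show ?thesis
    proof (rule upper_value_le[OF \<pi> B, where N = 0])
      fix h
      have "\<pi> h \<noteq> Some k" if "table_row (current_info \<nu> h) = 7"
        using avoid[of h] that info_class_less[of 4 3 "current_info \<nu> h 1"]
        by (simp add: table_row_def split: if_splits)
      then show "expected_gain trio_mab (current_info \<nu> h) (\<pi> h)
          + expected_next trio_mab (entry H) (current_info \<nu> h) (\<pi> h) \<le> 11134 + entry H (current_info \<nu> h)"
        using \<pi> by (intro trio_upper_step[OF seen_current_info[OF \<nu>] ok _ k]) (auto simp: policies_def)
    qed
  qed
  show ?thesis
    using index_policy_excludes[OF index, of 0 1 "(True, 1)" "(False, 2)"]
      le[OF table_without_safe_ok] le[OF table_without_fast_ok] by auto
qed

theorem theorem1:
  "(\<forall>\<delta>::real. 0 < \<delta> \<and> \<delta> < 1 \<longrightarrow>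
      (\<exists>c::real. 0 < c \<and>
        (\<forall>n::nat. 1 \<le> n \<longrightarrow>
          (\<exists>I. is_feedback_mab \<delta> I \<and> arms I = n \<and>
            (\<forall>\<nu> \<pi>. initial_info I \<nu> \<and> myopic_policy I \<nu> \<pi> \<longrightarrow>
               0 < upper_value I \<nu> \<pi> \<and>
               ereal (c * real n) * upper_value I \<nu> \<pi> \<le> optimal_value I \<nu>))))) \<and>
   (\<exists>c::real. 0 < c \<and>
      (\<exists>\<delta> I. is_feedback_mab \<delta> I \<and>
        (\<forall>\<nu>. initial_info I \<nu> \<longrightarrow>
           0 < optimal_value I \<nu> \<and>
           (\<forall>\<pi>. index_policy I \<nu> \<pi> \<longrightarrow>
              ereal (1 + c) * upper_value I \<nu> \<pi> \<le> optimal_value I \<nu>))))"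
proof (intro conjI allI impI)
  fix \<delta> :: real
  assume "0 < \<delta> \<and> \<delta> < 1"
  then have \<delta>: "0 < \<delta>" "\<delta> < 1" by auto
  show "\<exists>c::real. 0 < c \<and> (\<forall>n::nat. 1 \<le> n \<longrightarrow>
          (\<exists>I. is_feedback_mab \<delta> I \<and> arms I = n \<and>
            (\<forall>\<nu> \<pi>. initial_info I \<nu> \<and> myopic_policy I \<nu> \<pi> \<longrightarrow>
               0 < upper_value I \<nu> \<pi> \<and>
               ereal (c * real n) * upper_value I \<nu> \<pi> \<le> optimal_value I \<nu>)))"
  proof (intro exI[of _ "(1 - \<delta>) / 32"] conjI allI impI)
    fix n :: nat
    assume n: "1 \<le> n"
    show "\<exists>I. is_feedback_mab \<delta> I \<and> arms I = n \<and>
            (\<forall>\<nu> \<pi>. initial_info I \<nu> \<and> myopic_policy I \<nu> \<pi> \<longrightarrow>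
               0 < upper_value I \<nu> \<pi> \<and>
               ereal ((1 - \<delta>) / 32 * real n) * upper_value I \<nu> \<pi> \<le> optimal_value I \<nu>)"
      using is_feedback_needle_mab[OF \<delta> n] needle_simps(1)[OF \<delta> n] needle_myopic_pos[OF \<delta> n] myopic_gap[OF \<delta> n]
      by (intro exI[of _ "needle_mab \<delta> n"]) blast
  qed (use \<delta> in simp)
next
  have "ereal (1 + 1 / 20000) * upper_value trio_mab \<nu> \<pi> \<le> optimal_value trio_mab \<nu>"
    if "initial_info trio_mab \<nu>" "index_policy trio_mab \<nu> \<pi>" for \<nu> \<pi>
  proof -
    \<comment> \<open>The constant fits between the two bounds:
      \<open>11134 * (1 + 1 / 20000)\<close> is about 11134.6, below 11136.\<close>
    have "ereal (1 + 1 / 20000) * upper_value trio_mab \<nu> \<pi> \<le> ereal (1 + 1 / 20000) * ereal 11134"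
      using trio_index_le[OF that] by (intro ereal_mult_left_mono) auto
    also have "\<dots> \<le> ereal 11136" by simp
    also have "\<dots> \<le> optimal_value trio_mab \<nu>" by (rule trio_optimal_ge[OF that(1)])
    finally show ?thesis .
  qed
  moreover have "0 < optimal_value trio_mab \<nu>" if "initial_info trio_mab \<nu>" for \<nu>
    using trio_optimal_ge[OF that] by (rule less_le_trans[rotated]) simp
  ultimately show "\<exists>c::real. 0 < c \<and> (\<exists>\<delta> I. is_feedback_mab \<delta> I \<and>
        (\<forall>\<nu>. initial_info I \<nu> \<longrightarrow> 0 < optimal_value I \<nu> \<and>
           (\<forall>\<pi>. index_policy I \<nu> \<pi> \<longrightarrow>
              ereal (1 + c) * upper_value I \<nu> \<pi> \<le> optimal_value I \<nu>)))"
    using is_feedback_trio_mab by (intro exI[of _ "1 / 20000"] conjI exI[of _ "1 / 10"] exI[of _ trio_mab]) auto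
qed

end
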